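(* Let $\mathcal{N}$ be a finite ground set with $|\mathcal{N}|=n$, let $(\mathcal{N},\mathcal{I})$ be a $k$-extendible system, let $r$ be the largest size of a set in $\mathcal{I}$, and let $f:2^{\mathcal{N}}\to\mathbb{R}_{\ge 0}$ be a normalized ($f(\emptyset)=0$), non-negative submodular function accessed through a value oracle. Let $OPT\in\mathcal{I}$ be a set maximizing $f$ over $\mathcal{I}$. Let $0<p\le \frac{1}{1+k}$ and $0<\epsilon<p$, and let $S$ be the output of the algorithm SDTGA (described in the context) run with parameters $p,\epsilon$. Then $S\in\mathcal{I}$ and: (i) if $f$ is monotone, $\mathbb{E}[f(S)]\ge (p-\epsilon)\, f(OPT)$; (ii) if $f$ is not necessarily monotone, $\mathbb{E}[f(S)]\ge (p(1-p)-\epsilon)\, f(OPT)$; where the expectation is over the random sampling of the algorithm; moreover, the expected number of value oracle evaluations of $f$ made by the algorithm is $O\!\left(\frac{pn}{\epsilon}\ln\frac{r}{\epsilon}\right)$.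
   Context: A set function $f:2^{\mathcal{N}}\to\mathbb{R}$ is submodular if $f(X)+f(Y)\ge f(X\cap Y)+f(X\cup Y)$ for all $X,Y\subseteq\mathcal{N}$; it is monotone if $f(A)\le f(B)$ whenever $A\subseteq B$. The marginal gain is $\Delta f(u\mid S)=f(S\cup\{u\})-f(S)$. An independence system $(\mathcal{N},\mathcal{I})$ is a nonempty family $\mathcal{I}\subseteq 2^{\mathcal{N}}$ closed under taking subsets. It is $k$-extendible if for every $A\in\mathcal{I}$, every $B\in\mathcal{I}$ with $A\subsetneq B$, and every $u\notin A$ with $A\cup\{u\}\in\mathcal{I}$, there exists $X\subseteq B\setminus A$ with $|X|\le k$ such that $(B\setminus X)\cup\{u\}\in\mathcal{I}$. Algorithm SDTGA (input $f,\mathcal{N},\mathcal{I},r,p,\epsilon$): Set $S\leftarrow\emptyset$, $R\leftarrow\emptyset$. For each $u\in\mathcal{N}$, independently with probability $p$ add $u$ to $R$. Let $d=\max_{u\in R} f(\{u\})$. For $\theta=d$, decreasing by $\theta\leftarrow\theta(1-\epsilon)$ while $\theta\ge \frac{\epsilon}{r}d$: for each $u\in R$ in turn: if $S\cup\{u\}\notin\mathcal{I}$, remove $u$ from $R$; else if $\Delta f(u\mid S)\ge\theta$, add $u$ to $S$ and remove $u$ from $R$; else if $\Delta f(u\mid S)<\frac{\epsilon}{r}d$, remove $u$ from $R$. Finally return $S$.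
   Formalization: Bounds (i) and (ii) are proved assuming every singleton {u} is independent, and the evaluation bound assuming k ≥ 1 and r ≥ 1; without these the claims fail, e.g. when a dependent element of huge value inflates d. The loop also stops when R is empty. *)

theory Defs
  imports "HOL-Probability.Probability" "HOL-Library.While_Combinator"
begin

definition submodular_on :: "'a set \<Rightarrow> ('a set \<Rightarrow> real) \<Rightarrow> bool" where
  "submodular_on N f \<longleftrightarrow> (\<forall>X Y. X \<subseteq> N \<and> Y \<subseteq> N \<longrightarrow> f X + f Y \<ge> f (X \<inter> Y) + f (X \<union> Y))"

definition marginal_gain :: "('a set \<Rightarrow> real) \<Rightarrow> 'a \<Rightarrow> 'a set \<Rightarrow> real" where
  "marginal_gain f u S = f (S \<union> {u}) - f S"

definition independence_system :: "'a set \<Rightarrow> 'a set set \<Rightarrow> bool" where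
  "independence_system N I \<longleftrightarrow>
     I \<subseteq> Pow N \<and> I \<noteq> {} \<and> (\<forall>A B. A \<in> I \<and> B \<subseteq> A \<longrightarrow> B \<in> I)"

definition k_extendible :: "nat \<Rightarrow> 'a set \<Rightarrow> 'a set set \<Rightarrow> bool" where
  "k_extendible k N I \<longleftrightarrow>
     independence_system N I \<and>
     (\<forall>A \<in> I. \<forall>B \<in> I. \<forall>u. A \<subset> B \<and> u \<notin> A \<and> A \<union> {u} \<in> I \<longrightarrow>
        (\<exists>X. X \<subseteq> B - A \<and> card X \<le> k \<and> (B - X) \<union> {u} \<in> I))"

definition random_subset :: "'a set \<Rightarrow> real \<Rightarrow> 'a set pmf" where
  "random_subset N p =
     map_pmf (\<lambda>b. {u \<in> N. b u}) (Pi_pmf N False (\<lambda>_. bernoulli_pmf p))"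

text \<open>
  The state (S, R, q) of the algorithm consists of the current solution S, the remaining
  candidates R and the number q of value oracle evaluations made so far. Computing a marginal
  gain counts as two evaluations, since no value of f is cached; the gain is computed once and
  then compared with both thresholds.
\<close>

type_synonym 'a sdtga_state = "'a set \<times> 'a set \<times> nat"

definition sdtga_step ::
  "('a set \<Rightarrow> real) \<Rightarrow> 'a set set \<Rightarrow> real \<Rightarrow> real \<Rightarrow> 'a \<Rightarrow> 'a sdtga_state \<Rightarrow> 'a sdtga_state" where
  "sdtga_step f I lo \<theta> u = (\<lambda>(S, R, q).
     if u \<notin> R then (S, R, q)
     else if S \<union> {u} \<notin> I then (S, R - {u}, q)
     else if marginal_gain f u S \<ge> \<theta> then (S \<union> {u}, R - {u}, q + 2)
     else if marginal_gain f u S < lo then (S, R - {u}, q + 2)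
     else (S, R, q + 2))"

text \<open>
  The list \<open>us\<close> enumerates the ground set without repetition and fixes the order in which
  the candidates are visited. Elements outside R are skipped at no cost.
\<close>

definition sdtga_pass ::
  "('a set \<Rightarrow> real) \<Rightarrow> 'a list \<Rightarrow> 'a set set \<Rightarrow> real \<Rightarrow> real \<Rightarrow> 'a sdtga_state \<Rightarrow> 'a sdtga_state" where
  "sdtga_pass f us I lo \<theta> st = fold (sdtga_step f I lo \<theta>) us st"

text \<open>
  Once R is empty, further passes change neither the solution nor the number of evaluations, so
  the loop also stops in that case. This matters in degenerate situations only: if d = 0 or r = 0, the test
  \<open>\<theta> \<ge> \<epsilon> / r * d\<close> alone would never fail (the first pass then empties R), and
  if the sample is empty, d is the maximum of the empty set, which is never used.
  The initial value \<open>card R\<^sub>0\<close> of the counter accounts for the singleton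
  evaluations in the computation of d.
\<close>

definition sdtga_run ::
  "('a set \<Rightarrow> real) \<Rightarrow> 'a list \<Rightarrow> 'a set set \<Rightarrow> nat \<Rightarrow> real \<Rightarrow> 'a set \<Rightarrow> 'a set \<times> nat" where
  "sdtga_run f us I r \<epsilon> R\<^sub>0 =
     (let d = Max ((\<lambda>u. f {u}) ` R\<^sub>0);
          lo = \<epsilon> / real r * d;
          (_, S, _, q) =
            while (\<lambda>(\<theta>, S, R, q). \<theta> \<ge> lo \<and> R \<noteq> {})
                  (\<lambda>(\<theta>, st). (\<theta> * (1 - \<epsilon>), sdtga_pass f us I lo \<theta> st))
                  (d, {}, R\<^sub>0, card R\<^sub>0)
      in (S, q))"

text \<open>The joint distribution of the returned set and the number of evaluations.\<close>

definition sdtga ::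
  "('a set \<Rightarrow> real) \<Rightarrow> 'a list \<Rightarrow> 'a set set \<Rightarrow> nat \<Rightarrow> real \<Rightarrow> real \<Rightarrow> ('a set \<times> nat) pmf" where
  "sdtga f us I r p \<epsilon> = map_pmf (sdtga_run f us I r \<epsilon>) (random_subset (set us) p)"

end

(*
  Order of coin flips. Membership of an element in the sample can be decided by a fresh coin at the
  moment the algorithm would select it. The maximal singleton value d of the sample fits into this
  picture: revealing the coins by decreasing singleton values, the first success determines d, and
  all earlier elements were rejected when their marginal gain (with respect to the empty set) was
  maximal.

  Charging. Start with the competitor B = OPT and keep it a superset of the current solution: on
  acceptance of u remove at most k elements by k-extendibility, on rejection remove u. A removed
  element has marginal gain at most that of u divided by 1 - eps, and at most max (p k, 1 - p) <=
  1 - p elements are removed on average, while f gains p times the marginal gain. The elements left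
  at the end have total marginal gain at most eps d / (1 - eps), and f S >= d. This yields
  E (f S) >= p (1 - eps) E (f (S Un OPT)). Finally f (S Un OPT) >= f OPT if f is monotone, and
  E (f (S Un OPT)) >= (1 - p) f OPT in general, as every element is in S with probability at most p.
*)
theory Submission
  imports Defs
begin

section \<open>Random subsets\<close>

abbreviation expect_subset :: "real \<Rightarrow> 'a set \<Rightarrow> ('a set \<Rightarrow> real) \<Rightarrow> real" where
  "expect_subset p U F \<equiv> measure_pmf.expectation (random_subset U p) F"

lemma set_random_subset: "set_pmf (random_subset U p) \<subseteq> Pow U"
  by (auto simp: random_subset_def)

lemma integrable_random_subset:
  fixes F :: "'a set \<Rightarrow> real"
  assumes "finite U"
  shows "integrable (measure_pmf (random_subset U p)) F"
  using finite_subset[OF set_random_subset] assms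
  by (intro integrable_measure_pmf_finite) auto

lemma expect_subset_mono:
  assumes "finite U" and "\<And>Q. Q \<subseteq> U \<Longrightarrow> F Q \<le> G Q"
  shows "expect_subset p U F \<le> expect_subset p U G"
  using assms set_random_subset[of U p]
  by (intro integral_mono_AE integrable_random_subset) (auto simp: AE_measure_pmf_iff)

lemma expect_subset_cong:
  assumes "finite U" and "\<And>Q. Q \<subseteq> U \<Longrightarrow> F Q = G Q"
  shows "expect_subset p U F = expect_subset p U G"
  using assms by (intro antisym expect_subset_mono) auto

lemma expect_subset_add:
  assumes "finite U"
  shows "expect_subset p U (\<lambda>Q. F Q + G Q) = expect_subset p U F + expect_subset p U G"
  using assms by (intro Bochner_Integration.integral_add integrable_random_subset)

lemma expect_subset_add_const:
  assumes "finite U"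
  shows "expect_subset p U (\<lambda>Q. F Q + a) = expect_subset p U F + a"
  using assms by (simp add: expect_subset_add)

text \<open>Conditioning on the coin of \<open>u\<close>, which is independent of the coins of
  \<open>U\<close>. This is how single coins are revealed in the later inductions.\<close>

lemma expect_subset_insert:
  assumes "finite U" "u \<notin> U" "0 \<le> p" "p \<le> 1"
  shows "expect_subset p (insert u U) F =
    p * expect_subset p U (\<lambda>Q. F (insert u Q)) + (1 - p) * expect_subset p U F"
proof -
  have "random_subset (insert u U) p = bernoulli_pmf p \<bind>
      (\<lambda>b. map_pmf (\<lambda>Q. if b then insert u Q else Q) (random_subset U p))"
    using assms(1,2)
    by (auto simp: random_subset_def Pi_pmf_insert' map_bind_pmf pmf.map_comp o_def
        map_pmf_def[symmetric] intro!: bind_pmf_cong map_pmf_cong split: if_splits)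
  moreover have "finite (set_pmf (random_subset U p))"
    using finite_subset[OF set_random_subset] assms(1) by auto
  ultimately show ?thesis
    using assms(3,4) by (subst \<open>random_subset _ _ = _\<close>, subst pmf_expectation_bind[of UNIV])
      (auto simp: UNIV_bool)
qed

lemma expect_subset_member:
  assumes "finite U" "u \<in> U" "0 \<le> p" "p \<le> 1"
  shows "expect_subset p U (\<lambda>Q. of_bool (u \<in> Q)) = p"
proof -
  define V where "V = U - {u}"
  have V: "finite V" "u \<notin> V" "U = insert u V" using assms by (auto simp: V_def)
  have "expect_subset p V (\<lambda>Q. of_bool (u \<in> Q)) = expect_subset p V (\<lambda>_. 0)"
    using V by (intro expect_subset_cong) auto
  then show ?thesis using V assms by (simp add: expect_subset_insert)
qed

lemma expect_subset_card:
  assumes "finite U" "0 \<le> p" "p \<le> 1"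
  shows "expect_subset p U (\<lambda>Q. real (card Q)) = p * real (card U)"
  using assms(1)
proof (induction U rule: finite_induct)
  case empty
  then show ?case by (simp add: random_subset_def)
next
  case (insert u U)
  have "expect_subset p U (\<lambda>Q. real (card (insert u Q))) = expect_subset p U (\<lambda>Q. real (card Q) + 1)"
    using insert by (intro expect_subset_cong) (auto simp: card_insert_if finite_subset)
  also have "\<dots> = p * real (card U) + 1"
    by (subst expect_subset_add_const) (use insert in simp_all)
  finally show ?case using insert assms by (simp add: expect_subset_insert algebra_simps)
qed

section \<open>Submodular functions\<close>

lemma submodular_onD:
  "submodular_on N f \<Longrightarrow> X \<subseteq> N \<Longrightarrow> Y \<subseteq> N \<Longrightarrow> f (X \<inter> Y) + f (X \<union> Y) \<le> f X + f Y"
  by (simp add: submodular_on_def)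

lemma marginal_gain_antimono:
  assumes "submodular_on N f" "S \<subseteq> T" "T \<subseteq> N" "u \<in> N" "u \<notin> T"
  shows "marginal_gain f u T \<le> marginal_gain f u S"
proof -
  have "(S \<union> {u}) \<inter> T = S" "(S \<union> {u}) \<union> T = T \<union> {u}" using assms by auto
  then show ?thesis
    using submodular_onD[OF assms(1), of "S \<union> {u}" T] assms(2-) by (fastforce simp: marginal_gain_def)
qed

text \<open>Insert the elements of \<open>X\<close> one at a time: by diminishing returns each adds
  at most its gain at the smaller set \<open>S\<close>, and elements already in \<open>A\<close> add
  nothing.\<close>

lemma submodular_union_le:
  assumes sub: "submodular_on N f" and "finite X" "A \<union> X \<subseteq> N" "S \<subseteq> A" "0 \<le> M"
    and "\<And>x. x \<in> X \<Longrightarrow> marginal_gain f x S \<le> M"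
  shows "f (A \<union> X) \<le> f A + real (card X) * M"
  using assms(2-)
proof (induction X rule: finite_induct)
  case (insert x X)
  have "f (A \<union> insert x X) \<le> f (A \<union> X) + M"
  proof (cases "x \<in> A")
    case True
    then show ?thesis using insert by (simp add: insert_absorb)
  next
    case False
    then have "marginal_gain f x (A \<union> X) \<le> marginal_gain f x S"
      using insert by (intro marginal_gain_antimono[OF sub]) auto
    moreover have "marginal_gain f x S \<le> M" using insert by simp
    ultimately show ?thesis by (simp add: marginal_gain_def)
  qed
  with insert show ?case by (simp add: algebra_simps)
qed simp

text \<open>
  Adding elements by decreasing probability of membership, an Abel summation over the prefixes of
  this order leaves only nonnegative terms; the parameter \<open>y\<close> carries the summation through the
  induction.
\<close>

lemma expect_subset_sampled_union:
  fixes g :: "'a set \<Rightarrow> real"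
  assumes fin: "finite U" and V: "finite V" and sub: "submodular_on V g"
    and nonneg: "\<And>X. X \<subseteq> V \<Longrightarrow> 0 \<le> g X" and p: "0 \<le> p"
    and T: "\<And>v. v \<in> V \<Longrightarrow> expect_subset p U (\<lambda>Q. of_bool (v \<in> T Q)) \<le> p"
  shows "(1 - p) * g {} \<le> expect_subset p U (\<lambda>Q. g (T Q \<inter> V))"
proof -
  define x where "x v = expect_subset p U (\<lambda>Q. of_bool (v \<in> T Q))" for v
  have x0: "0 \<le> x v" for v
    unfolding x_def by (intro Bochner_Integration.integral_nonneg) auto
  have "W \<subseteq> V \<longrightarrow> (\<forall>y. 0 \<le> y \<and> y \<le> p \<and> (\<forall>v\<in>W. y \<le> x v) \<longrightarrow>
      (1 - p) * g {} + y * g W \<le> expect_subset p U (\<lambda>Q. g (T Q \<inter> W)))" if "finite W" for W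
    using that
  proof (induction W rule: finite_ranking_induct[where f = "\<lambda>v. - x v"])
    case empty
    show ?case
    proof (intro impI allI)
      fix y assume "0 \<le> y \<and> y \<le> p \<and> (\<forall>v\<in>{}. y \<le> x v)"
      then have "(y - p) * g {} \<le> 0" using nonneg[of "{}"] by (simp add: mult_nonpos_nonneg)
      then show "(1 - p) * g {} + y * g {} \<le> expect_subset p U (\<lambda>Q. g (T Q \<inter> {}))"
        by (simp add: algebra_simps)
    qed
  next
    case (insert u W)
    show ?case
    proof (cases "u \<in> W")
      case True
      with insert.IH show ?thesis by (simp add: insert_absorb)
    next
      case False
      show ?thesis
      proof (intro impI allI)
        fix y assume W: "insert u W \<subseteq> V" and y: "0 \<le> y \<and> y \<le> p \<and> (\<forall>v\<in>insert u W. y \<le> x v)"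
        have "x u \<le> p" using T W by (simp add: x_def)
        \<comment> \<open>The ranking makes \<open>u\<close> the least likely element of
          \<open>insert u W\<close>, so the induction hypothesis may be used with
          \<open>y = x u\<close>.\<close>
        then have "(1 - p) * g {} + x u * g W \<le> expect_subset p U (\<lambda>Q. g (T Q \<inter> W))"
          using insert W x0 by auto
        \<comment> \<open>Diminishing returns: the gain of \<open>u\<close> over the random part of
          \<open>W\<close> is at least its gain over all of \<open>W\<close>.\<close>
        moreover have "expect_subset p U
            (\<lambda>Q. g (T Q \<inter> W) + of_bool (u \<in> T Q) * (g (insert u W) - g W))
          \<le> expect_subset p U (\<lambda>Q. g (T Q \<inter> insert u W))"
        proof (intro expect_subset_mono fin)
          fix Q
          show "g (T Q \<inter> W) + of_bool (u \<in> T Q) * (g (insert u W) - g W) \<le> g (T Q \<inter> insert u W)"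
            using marginal_gain_antimono[OF sub, of "T Q \<inter> W" W u] W False
            by (cases "u \<in> T Q") (auto simp: marginal_gain_def)
        qed
        moreover have "expect_subset p U
            (\<lambda>Q. g (T Q \<inter> W) + of_bool (u \<in> T Q) * (g (insert u W) - g W))
          = expect_subset p U (\<lambda>Q. g (T Q \<inter> W)) + x u * (g (insert u W) - g W)"
          using fin by (simp add: expect_subset_add x_def)
        moreover have "y * g (insert u W) \<le> x u * g (insert u W)"
          using y nonneg[OF W] by (intro mult_right_mono) auto
        ultimately show "(1 - p) * g {} + y * g (insert u W)
            \<le> expect_subset p U (\<lambda>Q. g (T Q \<inter> insert u W))"
          by (simp add: algebra_simps)
      qed
    qed
  qed
  from this[OF V] show ?thesis using x0 p by (force dest: spec[of _ 0])
qed

section \<open>Greedy selection along a schedule\<close>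

text \<open>The algorithm without candidate set and counter: the sample \<open>Q\<close> stays
  fixed. Revisiting an element of \<open>S\<close> is harmless, since both branches return
  \<open>S\<close>.\<close>

definition greedy_step ::
  "('a set \<Rightarrow> real) \<Rightarrow> 'a set set \<Rightarrow> 'a set \<Rightarrow> real \<times> 'a \<Rightarrow> 'a set \<Rightarrow> 'a set" where
  "greedy_step f I Q = (\<lambda>(\<theta>, u) S.
     if u \<in> Q \<and> S \<union> {u} \<in> I \<and> \<theta> \<le> marginal_gain f u S then S \<union> {u} else S)"

definition greedy ::
  "('a set \<Rightarrow> real) \<Rightarrow> 'a set set \<Rightarrow> 'a set \<Rightarrow> (real \<times> 'a) list \<Rightarrow> 'a set \<Rightarrow> 'a set" where
  "greedy f I Q = fold (greedy_step f I Q)"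

text \<open>All visits of \<open>n\<close> passes are flattened into one list of threshold-element
  pairs, so that proofs can proceed by induction over single visits.\<close>

fun schedule :: "real \<Rightarrow> 'a list \<Rightarrow> nat \<Rightarrow> real \<Rightarrow> (real \<times> 'a) list" where
  "schedule \<epsilon> us 0 \<theta> = []"
| "schedule \<epsilon> us (Suc n) \<theta> = map (Pair \<theta>) us @ schedule \<epsilon> us n (\<theta> * (1 - \<epsilon>))"

lemma greedy_Nil [simp]: "greedy f I Q [] S = S"
  by (simp add: greedy_def)

lemma greedy_Cons [simp]: "greedy f I Q (x # \<sigma>) S = greedy f I Q \<sigma> (greedy_step f I Q x S)"
  by (simp add: greedy_def)

lemma greedy_append [simp]: "greedy f I Q (\<sigma> @ \<tau>) S = greedy f I Q \<tau> (greedy f I Q \<sigma> S)"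
  by (simp add: greedy_def)

lemma greedy_increasing: "S \<subseteq> greedy f I Q \<sigma> S"
proof (induction \<sigma> arbitrary: S)
  case (Cons x \<sigma>)
  have "S \<subseteq> greedy_step f I Q x S" by (auto simp: greedy_step_def split: prod.splits)
  with Cons show ?case by (auto dest: subsetD)
qed simp

lemma greedy_subset: "greedy f I Q \<sigma> S \<subseteq> S \<union> Q"
proof (induction \<sigma> arbitrary: S)
  case (Cons x \<sigma>)
  have "greedy_step f I Q x S \<subseteq> S \<union> Q" by (auto simp: greedy_step_def split: prod.splits)
  with Cons[of "greedy_step f I Q x S"] show ?case by auto
qed simp

lemma greedy_indep: "S \<in> I \<Longrightarrow> greedy f I Q \<sigma> S \<in> I"
  by (induction \<sigma> arbitrary: S) (auto simp: greedy_step_def split: prod.splits)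

text \<open>Once \<open>u\<close> is selected, its coin no longer influences the run; this permits
  revealing the coin only at the moment of selection.\<close>

lemma greedy_insert: "u \<in> S \<Longrightarrow> greedy f I (insert u Q) \<sigma> S = greedy f I Q \<sigma> S"
proof (induction \<sigma> arbitrary: S)
  case (Cons x \<sigma>)
  have "greedy_step f I (insert u Q) x S = greedy_step f I Q x S"
    using Cons.prems by (auto simp: greedy_step_def split: prod.splits)
  moreover have "u \<in> greedy_step f I Q x S"
    using Cons.prems by (auto simp: greedy_step_def split: prod.splits)
  ultimately show ?case using Cons.IH by simp
qed simp

lemma greedy_value_mono:
  "\<forall>x\<in>set \<sigma>. 0 \<le> fst x \<Longrightarrow> f S \<le> f (greedy f I Q \<sigma> S)"
proof (induction \<sigma> arbitrary: S)
  case (Cons x \<sigma>)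
  have "f S \<le> f (greedy_step f I Q x S)"
    using Cons.prems by (auto simp: greedy_step_def marginal_gain_def split: prod.splits)
  with Cons.IH[of "greedy_step f I Q x S"] Cons.prems show ?case by auto
qed simp

lemma schedule_add: "schedule \<epsilon> us (m + n) \<theta> =
    schedule \<epsilon> us m \<theta> @ schedule \<epsilon> us n (\<theta> * (1 - \<epsilon>) ^ m)"
  by (induction m arbitrary: \<theta>) (auto simp: mult_ac)

lemma schedule_threshold:
  "x \<in> set (schedule \<epsilon> us n \<theta>) \<Longrightarrow> \<exists>i<n. fst x = \<theta> * (1 - \<epsilon>) ^ i \<and> snd x \<in> set us"
proof (induction n arbitrary: \<theta>)
  case (Suc n)
  then consider "x \<in> set (map (Pair \<theta>) us)" | "x \<in> set (schedule \<epsilon> us n (\<theta> * (1 - \<epsilon>)))"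
    by auto
  then show ?case
  proof cases
    case 1
    then show ?thesis by (auto intro!: exI[of _ 0])
  next
    case 2
    from Suc.IH[OF this] obtain i where "i < n" "fst x = \<theta> * (1 - \<epsilon>) * (1 - \<epsilon>) ^ i" "snd x \<in> set us"
      by blast
    then show ?thesis by (intro exI[of _ "Suc i"]) (auto simp: mult_ac)
  qed
qed simp

section \<open>Reduction of the algorithm to the greedy selection\<close>

text \<open>
  The candidates dropped by the algorithm can never be selected later, as independence fails for
  supersets as well, and marginal gains decrease.
\<close>

definition sdtga_inv ::
  "('a set \<Rightarrow> real) \<Rightarrow> 'a set set \<Rightarrow> real \<Rightarrow> 'a set \<Rightarrow> 'a set \<Rightarrow> 'a set \<Rightarrow> bool" where
  "sdtga_inv f I lo Q S R \<longleftrightarrow> R \<subseteq> Q \<and> S \<in> I \<and>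
     (\<forall>u\<in>Q - R. u \<in> S \<or> S \<union> {u} \<notin> I \<or> marginal_gain f u S < lo)"

lemma independence_systemD: "independence_system N I \<Longrightarrow> A \<in> I \<Longrightarrow> B \<subseteq> A \<Longrightarrow> B \<in> I"
  by (auto simp: independence_system_def)

lemma sdtga_inv_insert:
  assumes ind: "independence_system N I" and sub: "submodular_on N f" and Q: "Q \<subseteq> N"
    and inv: "sdtga_inv f I lo Q S R" and u: "S \<union> {u} \<in> I"
  shows "sdtga_inv f I lo Q (S \<union> {u}) (R - {u})"
proof -
  have "v \<in> S \<union> {u} \<or> S \<union> {u} \<union> {v} \<notin> I \<or> marginal_gain f v (S \<union> {u}) < lo"
    if v: "v \<in> Q - R" for v
  proof (cases "v \<in> S \<union> {u} \<or> S \<union> {u} \<union> {v} \<notin> I")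
    case False
    then have "S \<union> {v} \<in> I" using independence_systemD[OF ind, of "S \<union> {u} \<union> {v}" "S \<union> {v}"] by auto
    then have "marginal_gain f v S < lo" using inv v False by (auto simp: sdtga_inv_def)
    moreover have "marginal_gain f v (S \<union> {u}) \<le> marginal_gain f v S"
      using ind u v Q False by (intro marginal_gain_antimono[OF sub]) (auto simp: independence_system_def)
    ultimately show ?thesis by simp
  qed auto
  with inv u show ?thesis by (auto simp: sdtga_inv_def)
qed

text \<open>Since \<open>lo \<le> \<theta>\<close>, a dropped candidate fails the test of the greedy
  step as well. The last claim serves the degenerate runs: for \<open>\<theta> = lo\<close> a
  visited candidate is either accepted or dropped, and for \<open>I = {{}}\<close> it is always
  dropped.\<close>

lemma sdtga_step_simulates:
  assumes ind: "independence_system N I" and sub: "submodular_on N f" and Q: "Q \<subseteq> N"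
    and inv: "sdtga_inv f I lo Q S R" and lo: "lo \<le> \<theta>"
    and step: "sdtga_step f I lo \<theta> u (S, R, q) = (S', R', q')"
  shows "S' = greedy_step f I Q (\<theta>, u) S" "sdtga_inv f I lo Q S' R'" "R' \<subseteq> R"
    "q' \<le> q + 2 * of_bool (u \<in> Q)" "\<theta> = lo \<or> I = {{}} \<Longrightarrow> u \<notin> R'"
proof -
  note step' = step[unfolded sdtga_step_def, simplified]
  note inv' = inv[unfolded sdtga_inv_def]
  show "S' = greedy_step f I Q (\<theta>, u) S"
    using step' inv' lo by (fastforce simp: greedy_step_def split: if_splits)
  show "sdtga_inv f I lo Q S' R'"
  proof (cases "u \<in> R \<and> S \<union> {u} \<in> I \<and> \<theta> \<le> marginal_gain f u S")
    case True
    then show ?thesis using step' sdtga_inv_insert[OF ind sub Q inv, of u] by auto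
  next
    case False
    then show ?thesis using step' inv' by (auto simp: sdtga_inv_def split: if_splits)
  qed
  show "R' \<subseteq> R" "q' \<le> q + 2 * of_bool (u \<in> Q)"
    using step' inv' by (auto split: if_splits)
  show "u \<notin> R'" if "\<theta> = lo \<or> I = {{}}"
    using step' that by (auto split: if_splits)
qed

lemma sdtga_pass_simulates:
  assumes ind: "independence_system N I" and sub: "submodular_on N f" and Q: "Q \<subseteq> N"
    and inv: "sdtga_inv f I lo Q S R" and lo: "lo \<le> \<theta>"
    and pass: "sdtga_pass f us I lo \<theta> (S, R, q) = (S', R', q')"
  shows "S' = greedy f I Q (map (Pair \<theta>) us) S \<and> sdtga_inv f I lo Q S' R' \<and> R' \<subseteq> R \<and>
    q' \<le> q + 2 * length (filter (\<lambda>u. u \<in> Q) us) \<and> (\<theta> = lo \<or> I = {{}} \<longrightarrow> R' \<inter> set us = {})"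
  using inv pass
proof (induction us arbitrary: S R q)
  case Nil
  then show ?case by (simp add: sdtga_pass_def)
next
  case (Cons u us)
  obtain S1 R1 q1 where 1: "sdtga_step f I lo \<theta> u (S, R, q) = (S1, R1, q1)"
    using prod_cases3 by blast
  note step = sdtga_step_simulates[OF ind sub Q Cons.prems(1) lo 1]
  have "sdtga_pass f us I lo \<theta> (S1, R1, q1) = (S', R', q')"
    using Cons.prems(2) 1 by (simp add: sdtga_pass_def)
  from Cons.IH[OF step(2) this] show ?case
    using step by (auto split: if_splits)
qed

abbreviation sdtga_iterate ::
  "('a set \<Rightarrow> real) \<Rightarrow> 'a list \<Rightarrow> 'a set set \<Rightarrow> real \<Rightarrow> real \<Rightarrow> nat \<Rightarrow> real \<times> 'a sdtga_state \<Rightarrow> real \<times> 'a sdtga_state" where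
  "sdtga_iterate f us I lo \<epsilon> n \<equiv>
     (\<lambda>(\<theta>, st). (\<theta> * (1 - \<epsilon>), sdtga_pass f us I lo \<theta> st)) ^^ n"

lemma fst_sdtga_iterate: "fst (sdtga_iterate f us I lo \<epsilon> n (\<theta>, st)) = \<theta> * (1 - \<epsilon>) ^ n"
  by (induction n) (auto simp: case_prod_beta)

lemma sdtga_iterate_simulates:
  assumes ind: "independence_system N I" and sub: "submodular_on N f" and Q: "Q \<subseteq> N"
    and us: "distinct us"
    and inv: "sdtga_inv f I lo Q S R" and lo: "\<And>i. i < n \<Longrightarrow> lo \<le> \<theta> * (1 - \<epsilon>) ^ i"
    and iter: "sdtga_iterate f us I lo \<epsilon> n (\<theta>, S, R, q) = (\<theta>', S', R', q')"
  shows "S' = greedy f I Q (schedule \<epsilon> us n \<theta>) S \<and> sdtga_inv f I lo Q S' R' \<and>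
    q' \<le> q + 2 * n * card (Q \<inter> set us)"
  using inv lo iter
proof (induction n arbitrary: \<theta> S R q)
  case 0
  then show ?case by simp
next
  case (Suc n)
  obtain S1 R1 q1 where 1: "sdtga_pass f us I lo \<theta> (S, R, q) = (S1, R1, q1)"
    using prod_cases3 by blast
  have "lo \<le> \<theta>" using Suc.prems(2)[of 0] by simp
  note pass = sdtga_pass_simulates[OF ind sub Q Suc.prems(1) this 1]
  have "length (filter (\<lambda>u. u \<in> Q) us) = card (Q \<inter> set us)"
    using us by (simp add: distinct_length_filter Int_def conj_commute)
  moreover have "sdtga_iterate f us I lo \<epsilon> n (\<theta> * (1 - \<epsilon>), S1, R1, q1) = (\<theta>', S', R', q')"
    using Suc.prems(3) 1 by (simp add: funpow_Suc_right del: funpow.simps)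
  moreover have "lo \<le> \<theta> * (1 - \<epsilon>) * (1 - \<epsilon>) ^ i" if "i < n" for i
    using Suc.prems(2)[of "Suc i"] that by (simp add: mult_ac)
  ultimately have IH: "S' = greedy f I Q (schedule \<epsilon> us n (\<theta> * (1 - \<epsilon>))) S1"
      "sdtga_inv f I lo Q S' R'" "q' \<le> q1 + 2 * n * card (Q \<inter> set us)"
      and q1: "q1 \<le> q + 2 * card (Q \<inter> set us)"
    using Suc.IH[of S1 R1 "\<theta> * (1 - \<epsilon>)" q1] pass by auto
  have "q' \<le> q + 2 * Suc n * card (Q \<inter> set us)" using IH(3) q1 by simp
  with IH(1,2) pass show ?case by simp
qed

text \<open>With no candidates left, the invariant blocks every sampled element at each threshold of
  at least \<open>lo\<close>, so passes skipped by an early stop may be added back.\<close>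

lemma greedy_exhausted:
  assumes "sdtga_inv f I lo Q S {}" and "\<forall>x\<in>set \<sigma>. lo \<le> fst x"
  shows "greedy f I Q \<sigma> S = S"
  using assms(2)
proof (induction \<sigma>)
  case (Cons x \<sigma>)
  have "greedy_step f I Q x S = S"
    using assms(1) Cons.prems
    by (cases x) (force simp: greedy_step_def sdtga_inv_def insert_absorb)
  with Cons show ?case by simp
qed simp

text \<open>
  The number of passes, made independent of the sample by ignoring the test for an empty candidate
  set; if \<open>lo = 0\<close>, one pass suffices.
\<close>

definition rounds :: "real \<Rightarrow> real \<Rightarrow> real \<Rightarrow> nat" where
  "rounds \<epsilon> lo d = (if 0 < lo then LEAST n. d * (1 - \<epsilon>) ^ n < lo else 1)"

lemma rounds_terminate:
  assumes "0 < lo" "0 < \<epsilon>" "\<epsilon> < 1"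
  shows "d * (1 - \<epsilon>) ^ rounds \<epsilon> lo d < lo"
proof -
  have "(\<lambda>n. d * (1 - \<epsilon>) ^ n) \<longlonglongrightarrow> d * 0"
    using assms by (intro tendsto_mult tendsto_const LIMSEQ_realpow_zero) auto
  then have "\<forall>\<^sub>F n in sequentially. d * (1 - \<epsilon>) ^ n < lo"
    using assms(1) by (intro order_tendstoD) auto
  then have "\<exists>n. d * (1 - \<epsilon>) ^ n < lo" by (auto simp: eventually_sequentially)
  from LeastI_ex[OF this] show ?thesis using assms by (simp add: rounds_def)
qed

text \<open>For \<open>lo = 0\<close> the count is 1, so only \<open>i = 0\<close> occurs and
  \<open>lo \<le> d\<close> suffices; otherwise this is the minimality of
  \<open>LEAST\<close>.\<close>

lemma rounds_minimal: "0 \<le> lo \<Longrightarrow> lo \<le> d \<Longrightarrow> i < rounds \<epsilon> lo d \<Longrightarrow> lo \<le> d * (1 - \<epsilon>) ^ i"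
  using not_less_Least[of i "\<lambda>n. d * (1 - \<epsilon>) ^ n < lo"]
  by (auto simp: rounds_def split: if_splits)

text \<open>The loop may end after \<open>K\<close> passes, earlier than the
  \<open>J = rounds \<epsilon> lo d\<close> passes dictated by the thresholds. The missing passes
  are added back without effect, so that the number of passes depends on the sample only through
  \<open>d\<close>.\<close>

lemma sdtga_run_eq_greedy:
  fixes \<epsilon> :: real
  assumes ind: "independence_system N I" and sub: "submodular_on N f" and fin: "finite N"
    and nonneg: "\<And>X. X \<subseteq> N \<Longrightarrow> 0 \<le> f X" and us: "distinct us" "set us = N"
    and r: "r = Max (card ` I)" and \<epsilon>: "0 < \<epsilon>" "\<epsilon> < 1"
    and Q: "Q \<subseteq> N" "Q \<noteq> {}"
  defines "d \<equiv> Max ((\<lambda>u. f {u}) ` Q)"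
  defines "lo \<equiv> \<epsilon> / real r * d"
  shows "fst (sdtga_run f us I r \<epsilon> Q) = greedy f I Q (schedule \<epsilon> us (rounds \<epsilon> lo d) d) {}"
    "snd (sdtga_run f us I r \<epsilon> Q) \<le> card Q + 2 * rounds \<epsilon> lo d * card Q"
proof -
  have finQ: "finite Q" using Q fin finite_subset by blast
  then have "d \<in> (\<lambda>u. f {u}) ` Q" unfolding d_def using Q by (intro Max_in) auto
  then have d: "0 \<le> d" using nonneg Q by auto
  have lo: "0 \<le> lo" using d \<epsilon> by (simp add: lo_def)
  have lo_le: "lo \<le> d"
  proof (cases "r = 0")
    case False
    then have "\<epsilon> / real r \<le> 1" using \<epsilon> by (simp add: divide_simps)
    with d show ?thesis unfolding lo_def using mult_right_mono by fastforce
  qed (use d lo_def in simp)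
  have I: "{} \<in> I" "I \<subseteq> Pow N" using ind by (auto simp: independence_system_def)
  have finI: "finite I" using I fin finite_subset by blast
  have r0: "I = {{}}" if "r = 0"
  proof -
    have "A = {}" if "A \<in> I" for A
    proof -
      have "card A \<le> r" unfolding r using finI that by (intro Max_ge) auto
      moreover have "finite A" using that I fin finite_subset by blast
      ultimately show ?thesis using \<open>r = 0\<close> by simp
    qed
    with I show ?thesis by auto
  qed
  define it where "it n = sdtga_iterate f us I lo \<epsilon> n (d, {}, Q, card Q)" for n
  define S where "S n = fst (snd (it n))" for n
  define R where "R n = fst (snd (snd (it n)))" for n
  define q where "q n = snd (snd (snd (it n)))" for n
  have it: "it n = (d * (1 - \<epsilon>) ^ n, S n, R n, q n)" for n
  proof -
    have "fst (it n) = d * (1 - \<epsilon>) ^ n" by (simp add: it_def fst_sdtga_iterate)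
    then show ?thesis by (simp add: S_def R_def q_def prod_eq_iff)
  qed
  have inv0: "sdtga_inv f I lo Q {} Q" using I by (simp add: sdtga_inv_def)
  have sim: "S n = greedy f I Q (schedule \<epsilon> us n d) {} \<and> sdtga_inv f I lo Q (S n) (R n) \<and>
      q n \<le> card Q + 2 * n * card Q" if "\<And>i. i < n \<Longrightarrow> lo \<le> d * (1 - \<epsilon>) ^ i" for n
    using sdtga_iterate_simulates[OF ind sub Q(1) us(1) inv0, where n = n and \<theta> = d and \<epsilon> = \<epsilon>,
        OF that it[unfolded it_def]] us Q
    unfolding us(2) Int_absorb2[OF Q(1)] by blast
  define J where "J = rounds \<epsilon> lo d"
  have J_min: "lo \<le> d * (1 - \<epsilon>) ^ i" if "i < J" for i
    using rounds_minimal[OF lo lo_le] that by (simp add: J_def)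
  \<comment> \<open>For \<open>lo = 0\<close> the thresholds never stop the loop; but then
    \<open>d = 0\<close> or \<open>r = 0\<close>, and a single pass empties the candidate
    set.\<close>
  have stop_J: "\<not> (lo \<le> d * (1 - \<epsilon>) ^ J \<and> R J \<noteq> {})"
  proof (cases "0 < lo")
    case True
    then show ?thesis using rounds_terminate[OF True \<epsilon>, of d] by (simp add: J_def)
  next
    case False
    then have lo0: "lo = 0" "J = 1" using lo by (auto simp: J_def rounds_def)
    then have "d = lo \<or> I = {{}}" using r0 \<epsilon> by (auto simp: lo_def)
    moreover have "sdtga_pass f us I lo d ({}, Q, card Q) = (S 1, R 1, q 1)"
      using it[of 1] by (simp add: it_def)
    ultimately have "R 1 \<inter> N = {}" "R 1 \<subseteq> Q"
      using sdtga_pass_simulates[OF ind sub Q(1) inv0 lo_le, of us "card Q" "S 1" "R 1" "q 1"]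
      unfolding us(2) by blast+
    then show ?thesis using lo0 Q by auto
  qed
  define stop where "stop n \<longleftrightarrow> \<not> (lo \<le> d * (1 - \<epsilon>) ^ n \<and> R n \<noteq> {})" for n
  define K where "K = (LEAST n. stop n)"
  have "stop J" using stop_J by (simp add: stop_def)
  then have stop_K: "stop K" and K: "K \<le> J"
    unfolding K_def by (rule LeastI, rule Least_le)
  have simK: "S K = greedy f I Q (schedule \<epsilon> us K d) {} \<and> sdtga_inv f I lo Q (S K) (R K) \<and>
      q K \<le> card Q + 2 * K * card Q"
    using K J_min by (intro sim) auto
  let ?b = "\<lambda>(\<theta>, S, R, q). lo \<le> \<theta> \<and> R \<noteq> {}"
  have stop_it: "\<not> ?b (it n) \<longleftrightarrow> stop n" for n
    unfolding it stop_def by simp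
  have "\<exists>n. stop n" using stop_K by (rule exI)
  \<comment> \<open>\<open>while_option\<close> is defined by the least number of iterations that
    falsifies the test, which is \<open>K\<close>.\<close>
  then have "while ?b (\<lambda>(\<theta>, st). (\<theta> * (1 - \<epsilon>), sdtga_pass f us I lo \<theta> st)) (d, {}, Q, card Q) = it K"
    unfolding while_def while_option_def it_def[symmetric] stop_it K_def by simp
  then have run: "sdtga_run f us I r \<epsilon> Q = (S K, q K)"
    unfolding sdtga_run_def Let_def d_def[symmetric] lo_def[symmetric] by (simp add: it)
  have "greedy f I Q (schedule \<epsilon> us J d) {} = S K"
  proof (cases "K = J")
    case False
    \<comment> \<open>For \<open>K < J\<close> the threshold is still at least \<open>lo\<close>, so
      the stop must be due to an empty candidate set.\<close>
    then have "R K = {}" using stop_K K J_min[of K] by (auto simp: stop_def)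
    have "\<forall>x\<in>set (schedule \<epsilon> us (J - K) (d * (1 - \<epsilon>) ^ K)). lo \<le> fst x"
    proof
      fix x assume "x \<in> set (schedule \<epsilon> us (J - K) (d * (1 - \<epsilon>) ^ K))"
      from schedule_threshold[OF this] obtain i
        where "i < J - K" "fst x = d * (1 - \<epsilon>) ^ (K + i)" by (auto simp: power_add mult_ac)
      then show "lo \<le> fst x" using J_min[of "K + i"] by simp
    qed
    moreover have "sdtga_inv f I lo Q (S K) {}" using simK \<open>R K = {}\<close> by metis
    ultimately have "greedy f I Q (schedule \<epsilon> us (J - K) (d * (1 - \<epsilon>) ^ K)) (S K) = S K"
      by (intro greedy_exhausted)
    then show ?thesis using schedule_add[of \<epsilon> us K "J - K" d] K simK by simp
  qed (use simK in simp)
  then show "fst (sdtga_run f us I r \<epsilon> Q) = greedy f I Q (schedule \<epsilon> us (rounds \<epsilon> lo d) d) {}"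
    by (simp add: run J_def)
  have "K * card Q \<le> J * card Q" using K by (rule mult_right_mono) simp
  then have "q K \<le> card Q + 2 * J * card Q" using simK by linarith
  then show "snd (sdtga_run f us I r \<epsilon> Q) \<le> card Q + 2 * rounds \<epsilon> lo d * card Q"
    by (simp add: run J_def)
qed

lemma sdtga_run_empty: "sdtga_run f us I r \<epsilon> {} = ({}, 0)"
  by (simp add: sdtga_run_def while_unfold)

text \<open>The last pass has threshold \<open>d * (1 - \<epsilon>) ^ (J - 1)\<close>, still at
  least \<open>\<epsilon> / real r * d\<close>. Using
  \<open>1 - \<epsilon> \<le> exp (- \<epsilon>)\<close> and taking logarithms bounds
  \<open>J - 1\<close>.\<close>

lemma rounds_le:
  assumes r: "1 \<le> r" and \<epsilon>: "0 < \<epsilon>" "\<epsilon> < 1" and d: "0 \<le> d"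
  shows "real (rounds \<epsilon> (\<epsilon> / real r * d) d) \<le> 1 + ln (real r / \<epsilon>) / \<epsilon>"
proof -
  have ln0: "0 \<le> ln (real r / \<epsilon>)" using r \<epsilon> by (intro ln_ge_zero) (simp add: divide_simps)
  define J where "J = rounds \<epsilon> (\<epsilon> / real r * d) d"
  show ?thesis
  proof (cases "d = 0 \<or> J = 0")
    case True
    moreover have "J = 1" if "d = 0" using that by (simp add: J_def rounds_def)
    ultimately have "real J \<le> 1" by auto
    moreover have "0 \<le> ln (real r / \<epsilon>) / \<epsilon>" using ln0 \<epsilon> by simp
    ultimately show ?thesis unfolding J_def by linarith
  next
    case False
    then have "\<epsilon> / real r * d \<le> d * (1 - \<epsilon>) ^ (J - 1)"
      using d r \<epsilon> by (intro rounds_minimal[where \<epsilon> = \<epsilon>]) (auto simp: J_def divide_simps)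
    then have "\<epsilon> / real r \<le> (1 - \<epsilon>) ^ (J - 1)"
      using False d by (subst mult_le_cancel_left_pos[of d, symmetric]) (auto simp: mult_ac)
    also have "\<dots> \<le> exp (- \<epsilon>) ^ (J - 1)"
      using \<epsilon> exp_ge_add_one_self[of "- \<epsilon>"] by (intro power_mono) auto
    also have "\<dots> = exp (- (real (J - 1) * \<epsilon>))" by (simp add: exp_of_nat_mult[symmetric])
    finally have "ln (\<epsilon> / real r) \<le> ln (exp (- (real (J - 1) * \<epsilon>)))"
      using r \<epsilon> by (intro ln_mono) auto
    then have "real (J - 1) * \<epsilon> \<le> ln (real r / \<epsilon>)" using r \<epsilon> by (simp add: ln_div)
    then have "real (J - 1) \<le> ln (real r / \<epsilon>) / \<epsilon>" using \<epsilon> by (simp add: divide_simps)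
    then show ?thesis using False unfolding J_def by (simp add: of_nat_diff)
  qed
qed

section \<open>The exchange argument\<close>

text \<open>Extendibility speaks of proper supersets only; if \<open>A = B\<close> or
  \<open>u\<close> lies in \<open>B\<close>, nothing has to be removed. The clause for
  \<open>u \<in> B\<close> records that accepting an element of the competitor costs
  nothing.\<close>

lemma k_extendible_exchange:
  assumes ext: "k_extendible k N I" and A: "A \<in> I" "A \<subseteq> B" "B \<in> I" "u \<notin> A" "A \<union> {u} \<in> I"
  shows "\<exists>X. X \<subseteq> B - A \<and> card X \<le> k \<and> B - X \<union> {u} \<in> I \<and> (u \<in> B \<longrightarrow> X = {})"
proof (cases "u \<in> B \<or> A = B")
  case True
  with A show ?thesis by (intro exI[of _ "{}"]) (auto simp: insert_absorb)
next
  case False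
  with A have "A \<subset> B" by auto
  with ext A False show ?thesis unfolding k_extendible_def by blast
qed

text \<open>
  \<open>m v\<close> bounds the current marginal gain of a competitor \<open>v\<close>: it was rejected at its
  previous visit, whose threshold exceeds the current one by the factor \<open>1 / (1 - \<epsilon>)\<close> only.
\<close>

fun valid_schedule :: "'a set \<Rightarrow> real \<Rightarrow> real \<Rightarrow> (real \<times> 'a) list \<Rightarrow> ('a \<Rightarrow> real) \<Rightarrow> bool" where
  "valid_schedule N \<epsilon> \<beta> [] m \<longleftrightarrow> (\<forall>v\<in>N. m v \<le> \<beta>)"
| "valid_schedule N \<epsilon> \<beta> ((\<theta>, u) # \<sigma>) m \<longleftrightarrow>
     0 \<le> \<theta> \<and> u \<in> N \<and> (\<forall>v\<in>N. m v \<le> \<theta> / (1 - \<epsilon>)) \<and> valid_schedule N \<epsilon> \<beta> \<sigma> (m(u := \<theta>))"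

text \<open>\<open>us\<close> is the remaining part of a pass: elements outside it have been visited
  already and satisfy the sharper bound \<open>\<theta>\<close>, while the others still carry the
  bound from the previous threshold.\<close>

lemma valid_schedule_pass:
  assumes "0 \<le> \<theta>" "0 \<le> \<epsilon>" "\<epsilon> < 1" "set us \<subseteq> N"
    and "\<forall>v\<in>N. m v \<le> \<theta> / (1 - \<epsilon>)" "\<forall>v\<in>N - set us. m v \<le> \<theta>"
    and "\<And>m. \<forall>v\<in>N. m v \<le> \<theta> \<Longrightarrow> valid_schedule N \<epsilon> \<beta> \<sigma> m"
  shows "valid_schedule N \<epsilon> \<beta> (map (Pair \<theta>) us @ \<sigma>) m"
  using assms(4-6)
proof (induction us arbitrary: m)
  case Nil
  then show ?case using assms(7) by simp
next
  case (Cons u us)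
  have "\<theta> * (1 - \<epsilon>) \<le> \<theta>" using assms(1-3) by (simp add: algebra_simps)
  then have "\<theta> \<le> \<theta> / (1 - \<epsilon>)" using assms(3) by (simp add: pos_le_divide_eq)
  then show ?case using Cons assms(1) by auto
qed

text \<open>After a pass every bound is at most \<open>\<theta>\<close>, which is the next threshold
  divided by \<open>1 - \<epsilon>\<close>. After the last pass this quotient is at most
  \<open>\<beta>\<close> by the final hypothesis.\<close>

lemma valid_schedule_schedule:
  assumes "0 \<le> \<theta>" "0 \<le> \<epsilon>" "\<epsilon> < 1" "set us = N"
    and "\<forall>v\<in>N. m v \<le> \<theta> / (1 - \<epsilon>)" "\<theta> * (1 - \<epsilon>) ^ n \<le> (1 - \<epsilon>) * \<beta>"
  shows "valid_schedule N \<epsilon> \<beta> (schedule \<epsilon> us n \<theta>) m"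
  using assms(1,5,6)
proof (induction n arbitrary: \<theta> m)
  case 0
  have "\<theta> / (1 - \<epsilon>) \<le> \<beta>" using 0 assms(3) by (simp add: divide_simps mult.commute)
  with 0 show ?case by force
next
  case (Suc n)
  have "valid_schedule N \<epsilon> \<beta> (schedule \<epsilon> us n (\<theta> * (1 - \<epsilon>))) m'" if "\<forall>v\<in>N. m' v \<le> \<theta>" for m'
    using that Suc.prems assms(3) by (intro Suc.IH) (auto simp: mult_ac)
  then show ?case
    using Suc.prems assms(2-4) by (auto intro!: valid_schedule_pass)
qed

text \<open>One coin flip, averaged: \<open>y\<close> and \<open>n\<close> are the expected values
  after acceptance and rejection, \<open>x\<close> and \<open>z\<close> the losses from shrinking
  the competitor. The bound is preserved when the gain \<open>g\<close>, weighted by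
  \<open>l\<close>, pays for the expected loss.\<close>

lemma convex_combination_bound:
  fixes p :: real
  assumes "Y \<le> y + l * (y - s - g) + b + x" "N \<le> n + l * (n - s) + b + z"
    and "p * x + (1 - p) * z \<le> p * (l * g)" "0 \<le> p" "p \<le> 1"
  shows "p * Y + (1 - p) * N \<le> (p * y + (1 - p) * n) + l * ((p * y + (1 - p) * n) - s) + b"
proof -
  have "p * Y + (1 - p) * N \<le>
      p * (y + l * (y - s - g) + b + x) + (1 - p) * (n + l * (n - s) + b + z)"
    using assms by (intro add_mono mult_left_mono) auto
  with assms(3) show ?thesis by (simp add: algebra_simps)
qed

locale sampled_greedy =
  fixes N :: "'a set" and I :: "'a set set" and k :: nat and f :: "'a set \<Rightarrow> real"
    and p \<epsilon> :: real
  assumes fin: "finite N" and ext: "k_extendible k N I" and sub: "submodular_on N f"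
    and f_empty: "f {} = 0" and f_nonneg: "\<And>X. X \<subseteq> N \<Longrightarrow> 0 \<le> f X"
    and p: "0 < p" "p \<le> 1 / (1 + real k)" and \<epsilon>: "0 < \<epsilon>" "\<epsilon> < p"
begin

lemma ind: "independence_system N I"
  using ext by (simp add: k_extendible_def)

lemma indep_subset: "A \<in> I \<Longrightarrow> A \<subseteq> N"
  using ind by (auto simp: independence_system_def)

lemma p_le_1: "p \<le> 1"
  using p(2) by (rule order_trans) (simp add: divide_simps)

text \<open>The balance behind the bound on \<open>p\<close>: removing \<open>k\<close> elements
  with probability \<open>p\<close> costs no more than removing one with probability
  \<open>1 - p\<close>.\<close>

lemma pk_le: "p * real k \<le> 1 - p"
  using p by (simp add: divide_simps algebra_simps split: if_splits)

lemma \<epsilon>_less_1: "\<epsilon> < 1"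
  using \<epsilon> p_le_1 by simp

lemma greedy_sub: "S \<subseteq> N \<Longrightarrow> Q \<subseteq> N \<Longrightarrow> greedy f I Q \<sigma> S \<subseteq> N"
  using greedy_subset[of f I Q \<sigma> S] by auto

text \<open>
  The competitor \<open>B\<close> always contains the current solution; an accepted element costs at most
  \<open>k\<close> of its remaining elements and a rejected one at most itself. The constant \<open>loss_ratio\<close>
  is chosen such that the expected gain of each coin flip pays for both.
\<close>

definition loss_ratio :: real where
  "loss_ratio = (1 - p) / (p * (1 - \<epsilon>))"

text \<open>Induction over the visits. \<open>U\<close> holds the elements whose coins are still
  hidden; the coin of \<open>u\<close> is revealed only when it decides a selection, and
  \<open>u\<close> then leaves \<open>U\<close>. At the end of the schedule each element of
  \<open>B - S\<close> has gain at most \<open>\<beta>\<close>, which yields the last term.\<close>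

lemma expected_greedy_union_le:
  assumes "valid_schedule N \<epsilon> \<beta> \<sigma> m" "0 \<le> \<beta>"
    and "S \<subseteq> B" "B \<in> I" "B - S \<subseteq> U" "U \<subseteq> N" "U \<inter> S = {}"
    and "\<forall>v\<in>B - S. marginal_gain f v S \<le> m v"
  shows "expect_subset p U (\<lambda>Q. f (greedy f I Q \<sigma> S \<union> B)) \<le>
    expect_subset p U (\<lambda>Q. f (greedy f I Q \<sigma> S)) +
    loss_ratio * (expect_subset p U (\<lambda>Q. f (greedy f I Q \<sigma> S)) - f S) + real (card (B - S)) * \<beta>"
  using assms(1,3-)
proof (induction \<sigma> arbitrary: m S B U)
  case Nil
  have "f (S \<union> (B - S)) \<le> f S + real (card (B - S)) * \<beta>"
  proof (rule submodular_union_le[OF sub])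
    show "finite (B - S)" using Nil fin finite_subset indep_subset by blast
    show "marginal_gain f x S \<le> \<beta>" if "x \<in> B - S" for x
      using Nil(1,7) that indep_subset[OF Nil(3)] by (auto intro: order_trans)
  qed (use Nil indep_subset[OF Nil(3)] assms(2) in auto)
  moreover have "S \<union> (B - S) = B" "S \<union> B = B" using Nil by auto
  ultimately show ?case by simp
next
  case (Cons x \<sigma>)
  obtain \<theta> u where x: "x = (\<theta>, u)" by (cases x)
  define m' where "m' = m(u := \<theta>)"
  have \<theta>: "0 \<le> \<theta>" "\<forall>v\<in>N. m v \<le> \<theta> / (1 - \<epsilon>)" and valid: "valid_schedule N \<epsilon> \<beta> \<sigma> m'" and u: "u \<in> N"
    using Cons.prems(1) by (auto simp: x m'_def)
  have BN: "B \<subseteq> N" using Cons.prems(3) by (rule indep_subset)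
  have SN: "S \<subseteq> N" using Cons.prems(2) BN by simp
  have SI: "S \<in> I" using independence_systemD[OF ind Cons.prems(3,2)] .
  have finU: "finite U" using Cons.prems(5) fin by (rule finite_subset)
  show ?case
  proof (cases "u \<in> U \<and> S \<union> {u} \<in> I \<and> \<theta> \<le> marginal_gain f u S")
    case False
    have "greedy f I Q (x # \<sigma>) S = greedy f I Q \<sigma> S" if "Q \<subseteq> U" for Q
      using False that by (auto simp: x greedy_step_def)
    then have eq: "expect_subset p U (\<lambda>Q. F (greedy f I Q (x # \<sigma>) S)) =
        expect_subset p U (\<lambda>Q. F (greedy f I Q \<sigma> S))" for F
      using finU by (intro expect_subset_cong) auto
    \<comment> \<open>If \<open>u\<close> is in \<open>B - S\<close>, its coin is hidden and it
      keeps \<open>S\<close> independent, so only the threshold test can have failed; its gain is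
      below \<open>\<theta>\<close>.\<close>
    have "marginal_gain f v S \<le> m' v" if v: "v \<in> B - S" for v
    proof (cases "v = u")
      case True
      have "S \<union> {u} \<in> I"
        using independence_systemD[OF ind Cons.prems(3)] v True Cons.prems(2) by auto
      with False True v Cons.prems show ?thesis by (auto simp: m'_def)
    qed (use Cons.prems v in \<open>auto simp: m'_def\<close>)
    then show ?thesis
      using Cons.IH[OF valid Cons.prems(2-6)] eq[of "\<lambda>T. f (T \<union> B)"] eq[of f] by simp
  next
    case True
    define V where "V = U - {u}"
    define g where "g = marginal_gain f u S"
    have V: "finite V" "u \<notin> V" "U = insert u V" "V \<subseteq> N" "u \<notin> S"
      using True finU Cons.prems by (auto simp: V_def)
    have \<theta>_g: "\<theta> / (1 - \<epsilon>) \<le> g / (1 - \<epsilon>)" "0 \<le> g"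
      using True \<theta> \<epsilon>_less_1 by (auto simp: g_def divide_simps)
    have fSu: "f (S \<union> {u}) = f S + g" by (simp add: g_def marginal_gain_def)
    define Yes where "Yes F = expect_subset p V (\<lambda>Q. F (greedy f I Q \<sigma> (S \<union> {u})))" for F :: "'a set \<Rightarrow> real"
    define No where "No F = expect_subset p V (\<lambda>Q. F (greedy f I Q \<sigma> S))" for F :: "'a set \<Rightarrow> real"
    have split: "expect_subset p U (\<lambda>Q. F (greedy f I Q (x # \<sigma>) S)) = p * Yes F + (1 - p) * No F" for F
    proof -
      have "greedy f I (insert u Q) (x # \<sigma>) S = greedy f I Q \<sigma> (S \<union> {u})" for Q
        using True by (simp add: x greedy_step_def greedy_insert)
      moreover have "expect_subset p V (\<lambda>Q. F (greedy f I Q (x # \<sigma>) S)) = No F"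
        unfolding No_def using V by (intro expect_subset_cong) (auto simp: x greedy_step_def)
      ultimately show ?thesis
        using V p p_le_1 by (simp add: expect_subset_insert Yes_def)
    qed
    have "S \<union> {u} \<in> I" using True by simp
    from k_extendible_exchange[OF ext SI Cons.prems(2,3) V(5) this]
    obtain X where X: "X \<subseteq> B - S" "card X \<le> k" "B - X \<union> {u} \<in> I" "u \<in> B \<longrightarrow> X = {}"
      by (elim exE conjE)
    have finB: "finite B" using BN fin by (rule finite_subset)
    have "X \<subseteq> B" using X(1) by auto
    then have finX: "finite X" using finB by (rule finite_subset)
    define B1 where "B1 = B - X \<union> {u}"
    have card1: "card (B1 - (S \<union> {u})) \<le> card (B - S)"
      using finB by (intro card_mono) (auto simp: B1_def)
    have "Yes (\<lambda>T. f (T \<union> B1)) \<le> Yes f + loss_ratio * (Yes f - f (S \<union> {u})) +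
        real (card (B1 - (S \<union> {u}))) * \<beta>"
      unfolding Yes_def
    proof (rule Cons.IH[OF valid])
      show "\<forall>v\<in>B1 - (S \<union> {u}). marginal_gain f v (S \<union> {u}) \<le> m' v"
      proof
        fix v assume v: "v \<in> B1 - (S \<union> {u})"
        have "marginal_gain f v (S \<union> {u}) \<le> marginal_gain f v S"
          using v BN SN u by (intro marginal_gain_antimono[OF sub]) (auto simp: B1_def)
        also have "\<dots> \<le> m v" using v Cons.prems by (auto simp: B1_def)
        finally show "marginal_gain f v (S \<union> {u}) \<le> m' v" using v by (simp add: m'_def)
      qed
      show "S \<union> {u} \<subseteq> B1" "B1 - (S \<union> {u}) \<subseteq> V" "V \<subseteq> N" "V \<inter> (S \<union> {u}) = {}"
        using X(1) Cons.prems(2-6) V(4) by (auto simp: B1_def V_def)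
    qed (use X(3) in \<open>simp add: B1_def\<close>)
    also have "\<dots> \<le> Yes f + loss_ratio * (Yes f - f (S \<union> {u})) + real (card (B - S)) * \<beta>"
      using mult_right_mono[OF of_nat_mono[OF card1] assms(2)] by simp
    finally have yes1: "Yes (\<lambda>T. f (T \<union> B1)) \<le>
      Yes f + loss_ratio * (Yes f - f (S \<union> {u})) + real (card (B - S)) * \<beta>" .
    \<comment> \<open>Putting \<open>X\<close> back costs at most
      \<open>\<theta> / (1 - \<epsilon>)\<close> per element, since gains at supersets of
      \<open>S\<close> are bounded by those at \<open>S\<close>.\<close>
    have "Yes (\<lambda>T. f (T \<union> B)) \<le> Yes (\<lambda>T. f (T \<union> B1) + real (card X) * (\<theta> / (1 - \<epsilon>)))"
      unfolding Yes_def
    proof (intro expect_subset_mono V(1))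
      fix Q assume Q: "Q \<subseteq> V"
      define T where "T = greedy f I Q \<sigma> (S \<union> {u})"
      have T: "S \<union> {u} \<subseteq> T" "T \<subseteq> N"
        unfolding T_def using Q V(4) SN u by (intro greedy_increasing greedy_sub; auto)+
      have "f ((T \<union> B1) \<union> X) \<le> f (T \<union> B1) + real (card X) * (\<theta> / (1 - \<epsilon>))"
      proof (rule submodular_union_le[OF sub finX, of _ S])
        show "marginal_gain f v S \<le> \<theta> / (1 - \<epsilon>)" if "v \<in> X" for v
        proof -
          have "v \<in> B - S" "v \<in> N" using that X(1) BN by auto
          then have "marginal_gain f v S \<le> m v" "m v \<le> \<theta> / (1 - \<epsilon>)"
            using Cons.prems(7) \<theta>(2) by auto
          then show ?thesis by (rule order_trans)
        qed
      qed (use T X(1) BN u \<theta>(1) \<epsilon>_less_1 in \<open>auto simp: B1_def\<close>)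
      moreover have "(T \<union> B1) \<union> X = T \<union> B" using T(1) X(1) by (auto simp: B1_def)
      ultimately show "f (T \<union> B) \<le> f (T \<union> B1) + real (card X) * (\<theta> / (1 - \<epsilon>))" by simp
    qed
    then have "Yes (\<lambda>T. f (T \<union> B)) \<le> Yes (\<lambda>T. f (T \<union> B1)) + real (card X) * (\<theta> / (1 - \<epsilon>))"
      unfolding Yes_def expect_subset_add_const[OF V(1)] .
    then have yes: "Yes (\<lambda>T. f (T \<union> B)) \<le> Yes f + loss_ratio * (Yes f - f S - g) +
        real (card (B - S)) * \<beta> + real (card X) * (\<theta> / (1 - \<epsilon>))"
      using yes1[unfolded fSu] by (simp add: diff_diff_eq)
    define B2 where "B2 = B - {u}"
    have card2: "card (B2 - S) \<le> card (B - S)"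
      using finB by (intro card_mono) (auto simp: B2_def)
    have "No (\<lambda>T. f (T \<union> B2)) \<le> No f + loss_ratio * (No f - f S) + real (card (B2 - S)) * \<beta>"
      unfolding No_def
    proof (rule Cons.IH[OF valid])
      show "B2 \<in> I" using independence_systemD[OF ind Cons.prems(3)] by (auto simp: B2_def)
      show "\<forall>v\<in>B2 - S. marginal_gain f v S \<le> m' v"
        using Cons.prems(7) by (auto simp: B2_def m'_def)
      show "S \<subseteq> B2" "B2 - S \<subseteq> V" "V \<subseteq> N" "V \<inter> S = {}"
        using Cons.prems(2-6) V(4,5) by (auto simp: B2_def V_def)
    qed
    also have "\<dots> \<le> No f + loss_ratio * (No f - f S) + real (card (B - S)) * \<beta>"
      using mult_right_mono[OF of_nat_mono[OF card2] assms(2)] by simp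
    finally have no2: "No (\<lambda>T. f (T \<union> B2)) \<le>
      No f + loss_ratio * (No f - f S) + real (card (B - S)) * \<beta>" .
    \<comment> \<open>After rejection only \<open>u\<close> was taken out of the competitor; putting
      it back costs at most its gain \<open>g\<close> at \<open>S\<close>.\<close>
    have "No (\<lambda>T. f (T \<union> B)) \<le> No (\<lambda>T. f (T \<union> B2) + of_bool (u \<in> B) * g)"
      unfolding No_def
    proof (intro expect_subset_mono V(1))
      fix Q assume Q: "Q \<subseteq> V"
      define T where "T = greedy f I Q \<sigma> S"
      have T: "S \<subseteq> T" "T \<subseteq> N"
        unfolding T_def using Q V(4) SN by (intro greedy_increasing greedy_sub; auto)+
      show "f (T \<union> B) \<le> f (T \<union> B2) + of_bool (u \<in> B) * g"
      proof (cases "u \<in> B")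
        case True
        have "f ((T \<union> B2) \<union> {u}) \<le> f (T \<union> B2) + real (card {u}) * g"
          using T BN u \<theta>_g(2)
          by (intro submodular_union_le[OF sub, of _ _ S]) (auto simp: B2_def g_def)
        moreover have "(T \<union> B2) \<union> {u} = T \<union> B" using True by (auto simp: B2_def)
        ultimately show ?thesis using True by simp
      qed (simp add: B2_def)
    qed
    then have no: "No (\<lambda>T. f (T \<union> B)) \<le> No f + loss_ratio * (No f - f S) +
        real (card (B - S)) * \<beta> + of_bool (u \<in> B) * g"
      using no2 V(1) by (simp add: No_def expect_subset_add_const)
    \<comment> \<open>If \<open>u\<close> lies in \<open>B\<close>, then \<open>X\<close> is empty
      and only rejection has a cost; otherwise only acceptance has one. Either way the average cost
      is at most \<open>(1 - p) * (g / (1 - \<epsilon>))\<close>, the value that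
      \<open>loss_ratio\<close> is chosen to match.\<close>
    have pay: "p * (real (card X) * (\<theta> / (1 - \<epsilon>))) + (1 - p) * (of_bool (u \<in> B) * g)
        \<le> p * (loss_ratio * g)"
    proof -
      have lr: "p * (loss_ratio * g) = (1 - p) * (g / (1 - \<epsilon>))"
        using p \<epsilon>_less_1 by (simp add: loss_ratio_def)
      show ?thesis
      proof (cases "u \<in> B")
        case True
        have "g * (1 - \<epsilon>) \<le> g" using \<theta>_g \<epsilon> by (simp add: algebra_simps)
        then have "g \<le> g / (1 - \<epsilon>)" using \<epsilon>_less_1 by (simp add: pos_le_divide_eq)
        then have "(1 - p) * g \<le> (1 - p) * (g / (1 - \<epsilon>))"
          using p_le_1 by (intro mult_left_mono) auto
        with True show ?thesis by (simp add: lr X(4))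
      next
        case False
        have "p * (real (card X) * (\<theta> / (1 - \<epsilon>))) \<le> p * (real k * (g / (1 - \<epsilon>)))"
          using p X(2) \<theta>_g \<theta> \<epsilon>_less_1 by (intro mult_left_mono mult_mono) auto
        also have "\<dots> = (p * real k) * (g / (1 - \<epsilon>))" by simp
        also have "\<dots> \<le> (1 - p) * (g / (1 - \<epsilon>))"
          using pk_le \<theta>_g \<epsilon>_less_1 by (intro mult_right_mono) auto
        finally show ?thesis using False by (simp add: lr)
      qed
    qed
    show ?thesis
      unfolding split[of "\<lambda>T. f (T \<union> B)"] split[of f]
      using p p_le_1 by (intro convex_combination_bound[OF yes no pay]) auto
  qed
qed

end

section \<open>Thresholds that depend on the sample\<close>

locale sdtga_sampling = sampled_greedy +
  fixes us :: "'a list" and r :: nat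
  assumes us: "distinct us" "set us = N" and r: "r = Max (card ` I)"
    and singleton: "\<And>u. u \<in> N \<Longrightarrow> {u} \<in> I"
begin

definition selection :: "'a set \<Rightarrow> 'a set" where
  "selection Q = fst (sdtga_run f us I r \<epsilon> Q)"

abbreviation thresholds :: "real \<Rightarrow> (real \<times> 'a) list" where
  "thresholds d \<equiv> schedule \<epsilon> us (rounds \<epsilon> (\<epsilon> / real r * d) d) d"

lemma selection_empty: "selection {} = {}"
  by (simp add: selection_def sdtga_run_empty)

lemma card_le_r: "A \<in> I \<Longrightarrow> card A \<le> r"
  unfolding r using indep_subset fin by (intro Max_ge finite_imageI) (auto intro: finite_subset[of I "Pow N"])

lemma selection_eq_greedy:
  assumes "Q \<subseteq> N" "Q \<noteq> {}"
  shows "selection Q = greedy f I Q (thresholds (Max ((\<lambda>u. f {u}) ` Q))) {}"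
  unfolding selection_def
  using sdtga_run_eq_greedy[OF ind sub fin f_nonneg us r \<epsilon>(1) \<epsilon>_less_1 assms] by simp

lemma selection_subset: "Q \<subseteq> N \<Longrightarrow> selection Q \<subseteq> Q"
  using greedy_subset[of f I Q _ "{}"] by (cases "Q = {}") (auto simp: selection_empty selection_eq_greedy)

lemma r_pos: "u \<in> N \<Longrightarrow> 1 \<le> r"
  using card_le_r[OF singleton] by force

lemma final_threshold:
  assumes "0 \<le> d" "1 \<le> r"
  shows "d * (1 - \<epsilon>) ^ rounds \<epsilon> (\<epsilon> / real r * d) d \<le> \<epsilon> / real r * d"
proof (cases "d = 0")
  case False
  then have "0 < \<epsilon> / real r * d" using assms \<epsilon> by simp
  from rounds_terminate[OF this \<epsilon>(1) \<epsilon>_less_1] show ?thesis by (simp add: less_imp_le)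
qed simp

lemma marginal_gain_le_singleton:
  assumes "S \<subseteq> N" "v \<in> N" "v \<notin> S"
  shows "marginal_gain f v S \<le> f {v}"
  using marginal_gain_antimono[OF sub, of "{}" S v] assms by (simp add: marginal_gain_def f_empty)

text \<open>
  The first element of \<open>us\<close> among the sampled ones of maximal singleton value is always selected
  first, hence the run may be started from it.
\<close>

lemma selection_insert_max:
  assumes V: "V \<subseteq> N" "Q \<subseteq> V" and t: "t \<in> N" "t \<notin> V" "\<And>v. v \<in> V \<Longrightarrow> f {v} \<le> f {t}"
    and first: "us = xs @ t # ys" "\<And>v. v \<in> V \<Longrightarrow> v \<in> set xs \<Longrightarrow> f {v} < f {t}"
  shows "selection (insert t Q) = greedy f I Q (thresholds (f {t})) {t}"
proof -
  define d where "d = f {t}"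
  define n where "n = rounds \<epsilon> (\<epsilon> / real r * d) d"
  have "finite Q" using V fin by (meson finite_subset order_trans)
  have d0: "0 \<le> d" using f_nonneg t by (simp add: d_def)
  have "Max ((\<lambda>u. f {u}) ` insert t Q) = d"
    unfolding d_def using \<open>finite Q\<close> V t(3) by (intro Max_eqI) auto
  then have out: "selection (insert t Q) = greedy f I (insert t Q) (schedule \<epsilon> us n d) {}"
    using selection_eq_greedy[of "insert t Q"] V t by (simp add: n_def subset_iff)
  \<comment> \<open>Zero passes would force \<open>d = 0\<close>, but for \<open>d = 0\<close> the
    count is 1 by definition.\<close>
  have n: "n \<noteq> 0"
  proof
    assume "n = 0"
    then have "d \<le> \<epsilon> / real r * d" using final_threshold[OF d0 r_pos[OF t(1)]] by (simp add: n_def)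
    moreover have "\<epsilon> / real r < 1" using r_pos[OF t(1)] \<epsilon>_less_1 \<epsilon> by (simp add: divide_simps)
    ultimately have "d \<le> 0" using d0 by (smt (verit) mult_less_cancel_right2)
    then show False using \<open>n = 0\<close> d0 by (simp add: n_def rounds_def)
  qed
  \<comment> \<open>Elements visited before \<open>t\<close> have singleton values strictly below
    the first threshold \<open>d\<close>, so they are skipped from either starting set.\<close>
  have prefix: "greedy f I (insert t Q) (map (Pair d) zs) S = S"
    if zs: "set zs \<subseteq> set xs" and S: "S = {} \<or> S = {t}" for zs S
    using zs
  proof (induction zs)
    case (Cons z zs)
    have "z \<noteq> t" using us(1) first(1) Cons.prems by auto
    have "marginal_gain f z S < d" if "z \<in> Q"
    proof -
      have "marginal_gain f z S \<le> f {z}"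
        using S that V t \<open>z \<noteq> t\<close> by (intro marginal_gain_le_singleton) auto
      also have "\<dots> < d" using first(2) that V Cons.prems by (auto simp: d_def)
      finally show ?thesis .
    qed
    then show ?case using Cons \<open>z \<noteq> t\<close> by (auto simp: greedy_step_def)
  qed simp
  have t1: "greedy_step f I (insert t Q) (d, t) {} = {t}"
    using singleton[OF t(1)] by (simp add: greedy_step_def marginal_gain_def f_empty d_def)
  have t2: "greedy_step f I (insert t Q) (d, t) {t} = {t}"
    by (simp add: greedy_step_def)
  obtain n' where "n = Suc n'" using n not0_implies_Suc by blast
  \<comment> \<open>Both starting sets lead to \<open>{t}\<close> once the first pass has visited
    \<open>t\<close>.\<close>
  then have "greedy f I (insert t Q) (schedule \<epsilon> us n d) {} =
      greedy f I (insert t Q) (schedule \<epsilon> us n d) {t}"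
    using prefix[of xs "{}"] prefix[of xs "{t}"] by (simp add: first(1) t1 t2)
  then show ?thesis by (simp add: out greedy_insert n_def d_def)
qed

definition approx_ratio :: real where
  "approx_ratio = 1 / (p * (1 - \<epsilon>))"

text \<open>The three terms account for the solution itself, the elements charged to coin flips, and
  the competitor elements left at the end.\<close>

lemma approx_ratio_eq: "1 + loss_ratio + \<epsilon> / (1 - \<epsilon>) = approx_ratio"
  using p \<epsilon>_less_1 by (simp add: loss_ratio_def approx_ratio_def field_simps)

text \<open>
  Here the maximal singleton value \<open>d\<close> is not known in advance. Revealing the coins by decreasing
  singleton values, the successes and failures are charged as for the later coins until the first
  success, which determines \<open>d\<close>.
\<close>

lemma expected_selection_union_le:
  assumes "U \<subseteq> N" "B \<subseteq> U" "B \<in> I"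
  shows "expect_subset p U (\<lambda>Q. f (selection Q \<union> B)) \<le> approx_ratio * expect_subset p U (\<lambda>Q. f (selection Q))"
proof -
  have "finite U" using assms(1) fin by (rule finite_subset)
  then show ?thesis using assms
  proof (induction "card U" arbitrary: U B)
    case 0
    then have "U = {}" "B = {}" by auto
    then show ?case by (simp add: random_subset_def selection_empty f_empty)
  next
    case (Suc c)
    define M where "M = Max ((\<lambda>u. f {u}) ` U)"
    have "U \<noteq> {}" using Suc by auto
    then have "M \<in> (\<lambda>u. f {u}) ` U" unfolding M_def using Suc by (intro Max_in) auto
    then have "\<exists>u\<in>set us. u \<in> U \<and> f {u} = M" using Suc us by auto
    \<comment> \<open>Ties are broken by the order of \<open>us\<close>: the maximal elements of
      \<open>U\<close> other than \<open>t\<close> come after \<open>t\<close>, as required for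
      \<open>t\<close> to be selected first.\<close>
    from split_list_first_prop[OF this] obtain xs t ys where
      first: "us = xs @ t # ys" and t: "t \<in> U" "f {t} = M"
      and before: "\<forall>v\<in>set xs. \<not> (v \<in> U \<and> f {v} = M)"
      by (elim exE conjE)
    define V where "V = U - {t}"
    have V: "finite V" "t \<notin> V" "U = insert t V" "V \<subseteq> N" "card V = c" "t \<in> N"
      using t Suc by (auto simp: V_def)
    have le_M: "f {v} \<le> M" if "v \<in> U" for v unfolding M_def using that Suc by (intro Max_ge) auto
    have M0: "0 \<le> M" using f_nonneg[of "{t}"] V t by simp
    have r1: "1 \<le> r" using V(6) by (rule r_pos)
    define Yes where "Yes F = expect_subset p V (\<lambda>Q. F (greedy f I Q (thresholds M) {t}))"
      for F :: "'a set \<Rightarrow> real"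
    define No where "No F = expect_subset p V (\<lambda>Q. F (selection Q))" for F :: "'a set \<Rightarrow> real"
    \<comment> \<open>Success of the coin of \<open>t\<close> fixes \<open>d = M\<close> and starts
      the greedy run from \<open>{t}\<close>; failure leaves the same problem on
      \<open>V\<close>.\<close>
    have split: "expect_subset p U (\<lambda>Q. F (selection Q)) = p * Yes F + (1 - p) * No F" for F
    proof -
      have "expect_subset p V (\<lambda>Q. F (selection (insert t Q))) = Yes F"
        unfolding Yes_def
      proof (intro expect_subset_cong V(1))
        fix Q assume "Q \<subseteq> V"
        then have "selection (insert t Q) = greedy f I Q (thresholds (f {t})) {t}"
        proof (intro selection_insert_max[of V _ _ xs ys] first)
          show "f {v} < f {t}" if "v \<in> V" "v \<in> set xs" for v
            using before le_M[of v] that t by (force simp: V_def)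
          show "f {v} \<le> f {t}" if "v \<in> V" for v
            using le_M[of v] that t by (simp add: V_def)
        qed (use V(2,4,6) in auto)
        then show "F (selection (insert t Q)) = F (greedy f I Q (thresholds M) {t})" by (simp add: t)
      qed
      then show ?thesis using V p p_le_1 by (simp add: expect_subset_insert No_def)
    qed
    have "{} \<in> I" using independence_systemD[OF ind Suc.prems(4)] by simp
    moreover have "{} \<union> {t} \<in> I" using singleton[OF V(6)] by simp
    ultimately obtain X where X: "X \<subseteq> B" "card X \<le> k" "B - X \<union> {t} \<in> I" "t \<in> B \<longrightarrow> X = {}"
      using k_extendible_exchange[OF ext, of "{}" B t] Suc.prems(4) by auto
    have BN: "B \<subseteq> N" using indep_subset Suc.prems(4) .
    have finB: "finite B" using BN fin by (rule finite_subset)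
    have finX: "finite X" using X(1) finB by (rule finite_subset)
    define B1 where "B1 = B - X \<union> {t}"
    \<comment> \<open>The final threshold divided by \<open>1 - \<epsilon>\<close>; at most
      \<open>r\<close> remaining elements then contribute at most
      \<open>\<epsilon> / (1 - \<epsilon>) * M\<close> together.\<close>
    define \<beta> where "\<beta> = \<epsilon> / real r * M / (1 - \<epsilon>)"
    have \<beta>: "0 \<le> \<beta>" using \<epsilon> \<epsilon>_less_1 M0 by (simp add: \<beta>_def)
    have nonneg_thresholds: "\<forall>x\<in>set (thresholds M). 0 \<le> fst x"
      using schedule_threshold[of _ \<epsilon> us _ M] M0 \<epsilon>_less_1 by fastforce
    have "Yes (\<lambda>T. f (T \<union> B1)) \<le> Yes f + loss_ratio * (Yes f - f {t}) + real (card (B1 - {t})) * \<beta>"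
      unfolding Yes_def
    \<comment> \<open>The constant bound \<open>M\<close> is valid initially: every relevant gain is
      at most a singleton value, and the first threshold is \<open>M\<close>.\<close>
    proof (rule expected_greedy_union_le[where m = "\<lambda>_. M"])
      have "M * (1 - \<epsilon>) \<le> M" using M0 \<epsilon> by (simp add: algebra_simps)
      then have "M \<le> M / (1 - \<epsilon>)" using \<epsilon>_less_1 by (simp add: pos_le_divide_eq)
      then show "valid_schedule N \<epsilon> \<beta> (thresholds M) (\<lambda>_. M)"
        using M0 \<epsilon> \<epsilon>_less_1 us final_threshold[OF M0 r1]
        by (intro valid_schedule_schedule) (auto simp: \<beta>_def)
      show "\<forall>v\<in>B1 - {t}. marginal_gain f v {t} \<le> M"
      proof
        fix v assume v: "v \<in> B1 - {t}"
        then have "v \<in> U" using Suc.prems by (auto simp: B1_def)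
        then show "marginal_gain f v {t} \<le> M"
          using marginal_gain_le_singleton[of "{t}" v] v V(6) le_M[of v] Suc.prems(2) by fastforce
      qed
          show "{t} \<subseteq> B1" "B1 - {t} \<subseteq> V" "V \<subseteq> N" "V \<inter> {t} = {}"
        using X(1) Suc.prems(3) V(4) by (auto simp: B1_def V_def)
      show "B1 \<in> I" using X(3) by (simp add: B1_def)
    qed (use \<beta> in simp)
    moreover have "real (card (B1 - {t})) * \<beta> \<le> \<epsilon> / (1 - \<epsilon>) * M"
    proof -
      have "card (B1 - {t}) \<le> card B1" using finB by (intro card_mono) (auto simp: B1_def)
      also have "\<dots> \<le> r" using card_le_r X(3) by (simp add: B1_def)
      finally have "real (card (B1 - {t})) * \<beta> \<le> real r * \<beta>" using \<beta> by (intro mult_right_mono) auto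
      then show ?thesis using r1 by (simp add: \<beta>_def)
    qed
    \<comment> \<open>The run starts from \<open>{t}\<close> and never decreases \<open>f\<close>,
      so the leftover term is absorbed by a multiple of the solution value.\<close>
    moreover have "\<epsilon> / (1 - \<epsilon>) * M \<le> \<epsilon> / (1 - \<epsilon>) * Yes f"
    proof (intro mult_left_mono)
      have "expect_subset p V (\<lambda>_. f {t}) \<le> Yes f"
        unfolding Yes_def using V(1) greedy_value_mono[OF nonneg_thresholds]
        by (intro expect_subset_mono)
      then show "M \<le> Yes f" by (simp add: t)
    qed (use \<epsilon> \<epsilon>_less_1 in simp)
    ultimately have yes1: "Yes (\<lambda>T. f (T \<union> B1)) \<le> approx_ratio * Yes f - loss_ratio * M"
      unfolding approx_ratio_eq[symmetric] by (simp add: t algebra_simps)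
    have "Yes (\<lambda>T. f (T \<union> B)) \<le> Yes (\<lambda>T. f (T \<union> B1) + real (card X) * M)"
      unfolding Yes_def
    proof (intro expect_subset_mono V(1))
      fix Q assume Q: "Q \<subseteq> V"
      define T where "T = greedy f I Q (thresholds M) {t}"
      have T: "{t} \<subseteq> T" "T \<subseteq> N"
        unfolding T_def using Q V(4,6) by (intro greedy_increasing greedy_sub; auto)+
      have "f ((T \<union> B1) \<union> X) \<le> f (T \<union> B1) + real (card X) * M"
      proof (rule submodular_union_le[OF sub finX, of _ "{}"])
        show "marginal_gain f v {} \<le> M" if "v \<in> X" for v
          using that X(1) Suc.prems le_M[of v] by (auto simp: marginal_gain_def f_empty)
      qed (use T X(1) BN V(6) M0 in \<open>auto simp: B1_def\<close>)
      moreover have "(T \<union> B1) \<union> X = T \<union> B" using T(1) X(1) by (auto simp: B1_def)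
      ultimately show "f (T \<union> B) \<le> f (T \<union> B1) + real (card X) * M" by simp
    qed
    then have yes: "Yes (\<lambda>T. f (T \<union> B)) \<le> approx_ratio * Yes f - loss_ratio * M + real (card X) * M"
      using yes1 V(1) by (simp add: Yes_def expect_subset_add_const)
    define B2 where "B2 = B - {t}"
    have no2: "No (\<lambda>T. f (T \<union> B2)) \<le> approx_ratio * No f"
      unfolding No_def
    proof (rule Suc.hyps(1))
      show "B2 \<in> I" using independence_systemD[OF ind Suc.prems(4)] by (auto simp: B2_def)
      show "B2 \<subseteq> V" using Suc.prems(3) by (auto simp: B2_def V_def)
    qed (use V(1,4,5) in simp_all)
    have "No (\<lambda>T. f (T \<union> B)) \<le> No (\<lambda>T. f (T \<union> B2) + of_bool (t \<in> B) * M)"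
      unfolding No_def
    proof (intro expect_subset_mono V(1))
      fix Q assume "Q \<subseteq> V"
      then have T: "selection Q \<subseteq> N" using selection_subset[of Q] V by auto
      show "f (selection Q \<union> B) \<le> f (selection Q \<union> B2) + of_bool (t \<in> B) * M"
      proof (cases "t \<in> B")
        case True
        have "f ((selection Q \<union> B2) \<union> {t}) \<le> f (selection Q \<union> B2) + real (card {t}) * M"
          using T BN V(6) M0 t
          by (intro submodular_union_le[OF sub, of _ _ "{}"])
            (auto simp: B2_def marginal_gain_def f_empty)
        moreover have "(selection Q \<union> B2) \<union> {t} = selection Q \<union> B" using True by (auto simp: B2_def)
        ultimately show ?thesis using True by simp
      qed (simp add: B2_def)
    qed
    then have no: "No (\<lambda>T. f (T \<union> B)) \<le> approx_ratio * No f + of_bool (t \<in> B) * M"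
      using no2 V(1) by (simp add: No_def expect_subset_add_const)
    \<comment> \<open>The same balance as for later coins, now with the gain
      \<open>f {t} = M\<close> of the first selection at the empty set.\<close>
    have pay: "p * (real (card X) * M) + (1 - p) * (of_bool (t \<in> B) * M) \<le> p * (loss_ratio * M)"
    proof -
      have "p * real (card X) + (1 - p) * of_bool (t \<in> B) \<le> 1 - p"
      proof (cases "t \<in> B")
        case False
        have "p * real (card X) \<le> p * real k" using X(2) p by simp
        with False show ?thesis using pk_le by simp
      qed (simp add: X(4))
      then have "(p * real (card X) + (1 - p) * of_bool (t \<in> B)) * M \<le> (1 - p) * M"
        using M0 by (rule mult_right_mono)
      also have "\<dots> \<le> (1 - p) * (M / (1 - \<epsilon>))"
      proof (intro mult_left_mono)
        have "M * (1 - \<epsilon>) \<le> M" using M0 \<epsilon> by (simp add: algebra_simps)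
        then show "M \<le> M / (1 - \<epsilon>)" using \<epsilon>_less_1 by (simp add: pos_le_divide_eq)
      qed (use p_le_1 in simp)
      also have "\<dots> = p * (loss_ratio * M)" using p by (simp add: loss_ratio_def)
      finally show ?thesis by (simp add: algebra_simps)
    qed
    have "p * Yes (\<lambda>T. f (T \<union> B)) + (1 - p) * No (\<lambda>T. f (T \<union> B)) \<le>
      p * (approx_ratio * Yes f - loss_ratio * M + real (card X) * M) +
      (1 - p) * (approx_ratio * No f + of_bool (t \<in> B) * M)"
      using yes no p p_le_1 by (intro add_mono mult_left_mono) auto
    also have "\<dots> = approx_ratio * (p * Yes f + (1 - p) * No f) +
      (p * (real (card X) * M) + (1 - p) * (of_bool (t \<in> B) * M) - p * (loss_ratio * M))"
      by (simp only: ring_distribs mult_ac)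
    finally show ?case
      unfolding split[of "\<lambda>T. f (T \<union> B)"] split[of f] using pay by linarith
  qed
qed

section \<open>Approximation guarantees\<close>

lemma expected_selection_ge:
  assumes "B \<in> I"
  shows "p * (1 - \<epsilon>) * expect_subset p N (\<lambda>Q. f (selection Q \<union> B)) \<le> expect_subset p N (\<lambda>Q. f (selection Q))"
  using expected_selection_union_le[OF order_refl indep_subset[OF assms] assms] p \<epsilon>_less_1
  by (simp add: approx_ratio_def pos_le_divide_eq mult.commute)

lemma expected_selection_ge_monotone:
  assumes "B \<in> I" and mono: "mono_on (Pow N) f"
  shows "(p - \<epsilon>) * f B \<le> expect_subset p N (\<lambda>Q. f (selection Q))"
proof -
  have B: "B \<subseteq> N" "0 \<le> f B" using assms indep_subset f_nonneg by auto
  have "expect_subset p N (\<lambda>_. f B) \<le> expect_subset p N (\<lambda>Q. f (selection Q \<union> B))"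
  proof (intro expect_subset_mono fin)
    fix Q assume "Q \<subseteq> N"
    then show "f B \<le> f (selection Q \<union> B)"
      using selection_subset[of Q] B by (intro mono_onD[OF mono]) auto
  qed
  then have "p * (1 - \<epsilon>) * f B \<le> p * (1 - \<epsilon>) * expect_subset p N (\<lambda>Q. f (selection Q \<union> B))"
    using p \<epsilon>_less_1 by (intro mult_left_mono) auto
  moreover have "p - \<epsilon> \<le> p * (1 - \<epsilon>)" using p_le_1 \<epsilon> by (simp add: algebra_simps)
  then have "(p - \<epsilon>) * f B \<le> p * (1 - \<epsilon>) * f B" using B by (intro mult_right_mono)
  ultimately show ?thesis using expected_selection_ge[OF assms(1)] by linarith
qed

text \<open>The sampling bound is applied to the submodular function mapping \<open>X\<close> to
  \<open>f (X \<union> B)\<close>: the selection lies in the sample, so it contains each element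
  with probability at most \<open>p\<close>, however its members depend on each other.\<close>

lemma expected_selection_ge_nonmonotone:
  assumes "B \<in> I"
  shows "(p * (1 - p) - \<epsilon>) * f B \<le> expect_subset p N (\<lambda>Q. f (selection Q))"
proof -
  have B: "B \<subseteq> N" "0 \<le> f B" using assms indep_subset f_nonneg by auto
  have "(1 - p) * f ({} \<union> B) \<le> expect_subset p N (\<lambda>Q. f (selection Q \<inter> N \<union> B))"
  proof (rule expect_subset_sampled_union[OF fin fin, where g = "\<lambda>X. f (X \<union> B)"])
    show "submodular_on N (\<lambda>X. f (X \<union> B))"
      unfolding submodular_on_def
    proof (intro allI impI)
      fix X Y assume XY: "X \<subseteq> N \<and> Y \<subseteq> N"
      have "(X \<union> B) \<inter> (Y \<union> B) = X \<inter> Y \<union> B" "(X \<union> B) \<union> (Y \<union> B) = X \<union> Y \<union> B" by auto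
      then show "f (X \<inter> Y \<union> B) + f (X \<union> Y \<union> B) \<le> f (X \<union> B) + f (Y \<union> B)"
        using submodular_onD[OF sub, of "X \<union> B" "Y \<union> B"] XY B by auto
    qed
    show "expect_subset p N (\<lambda>Q. of_bool (v \<in> selection Q)) \<le> p" if "v \<in> N" for v
    proof -
      have "expect_subset p N (\<lambda>Q. of_bool (v \<in> selection Q)) \<le> expect_subset p N (\<lambda>Q. of_bool (v \<in> Q))"
        using selection_subset fin by (intro expect_subset_mono) auto
      also have "\<dots> = p" using fin that p p_le_1 by (intro expect_subset_member) auto
      finally show ?thesis .
    qed
  qed (use B f_nonneg p in auto)
  also have "\<dots> = expect_subset p N (\<lambda>Q. f (selection Q \<union> B))"
  proof (intro expect_subset_cong fin)
    fix Q assume "Q \<subseteq> N"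
    then have "selection Q \<inter> N = selection Q" using selection_subset by auto
    then show "f (selection Q \<inter> N \<union> B) = f (selection Q \<union> B)" by simp
  qed
  finally have "p * (1 - \<epsilon>) * ((1 - p) * f B) \<le> p * (1 - \<epsilon>) * expect_subset p N (\<lambda>Q. f (selection Q \<union> B))"
    using p \<epsilon>_less_1 by (intro mult_left_mono) auto
  moreover have "p * (1 - p) - \<epsilon> \<le> p * (1 - \<epsilon>) * (1 - p)"
  proof -
    have "p * (1 - p) \<le> 1" using p p_le_1 by (intro mult_le_one) auto
    then have "\<epsilon> * (p * (1 - p)) \<le> \<epsilon> * 1" using \<epsilon> by (intro mult_left_mono) auto
    then show ?thesis by (simp add: algebra_simps)
  qed
  then have "(p * (1 - p) - \<epsilon>) * f B \<le> p * (1 - \<epsilon>) * (1 - p) * f B" using B by (intro mult_right_mono)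
  ultimately show ?thesis using expected_selection_ge[OF assms] by (simp add: mult.assoc)
qed

end

section \<open>Expected number of evaluations\<close>

lemma expected_queries_le:
  assumes ind: "independence_system N I" and sub: "submodular_on N f" and fin: "finite N"
    and nonneg: "\<And>X. X \<subseteq> N \<Longrightarrow> 0 \<le> f X" and us: "distinct us" "set us = N"
    and r: "r = Max (card ` I)" "1 \<le> r" and \<epsilon>: "0 < \<epsilon>" "\<epsilon> < p" and p: "p \<le> 1 / 2"
  shows "expect_subset p N (\<lambda>Q. real (snd (sdtga_run f us I r \<epsilon> Q)))
    \<le> 5 * (p * real (card N) / \<epsilon> * ln (real r / \<epsilon>))"
proof -
  define L where "L = ln (real r / \<epsilon>) / \<epsilon>"
  \<comment> \<open>From \<open>\<epsilon> < p \<le> 1 / 2\<close> the logarithm is at least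
    \<open>ln 2\<close>, hence at least \<open>1 / 2\<close>, and dividing by
    \<open>\<epsilon>\<close> gives at least 1. This lets additive constants be absorbed into
    \<open>L\<close>.\<close>
  have L: "1 \<le> L"
  proof -
    have "2 \<le> real r / \<epsilon>" using r(2) \<epsilon> p by (simp add: divide_simps)
    then have "ln 2 \<le> ln (real r / \<epsilon>)" by simp
    moreover have "1 / 2 \<le> ln (2 :: real)" using ln_2_less_1 ln_le_minus_one[of "1 / 2 :: real"] by (simp add: ln_div)
    ultimately show ?thesis using \<epsilon> p by (simp add: L_def divide_simps)
  qed
  have "real (snd (sdtga_run f us I r \<epsilon> Q)) \<le> real (card Q) * (5 * L)" if Q: "Q \<subseteq> N" for Q
  proof (cases "Q = {}")
    case False
    define d where "d = Max ((\<lambda>u. f {u}) ` Q)"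
    define J where "J = rounds \<epsilon> (\<epsilon> / real r * d) d"
    have "finite Q" using Q fin finite_subset by blast
    then have "d \<in> (\<lambda>u. f {u}) ` Q" unfolding d_def using False by (intro Max_in) auto
    then have d: "0 \<le> d" using nonneg Q by auto
    have "real J \<le> 1 + L" unfolding J_def L_def using r \<epsilon> p d by (intro rounds_le) auto
    \<comment> \<open>The constant 5 arises here: \<open>1 + 2 * (1 + L) = 3 + 2 * L\<close>, and
      \<open>1 \<le> L\<close>.\<close>
    with L have J: "1 + 2 * real J \<le> 5 * L" by simp
    have "snd (sdtga_run f us I r \<epsilon> Q) \<le> card Q + 2 * J * card Q"
      using sdtga_run_eq_greedy(2)[OF ind sub fin nonneg us r(1) \<epsilon>(1) _ Q False] \<epsilon> p
      by (simp add: J_def d_def)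
    then have "real (snd (sdtga_run f us I r \<epsilon> Q)) \<le> real (card Q) * (1 + 2 * real J)"
      unfolding of_nat_le_iff[where 'a = real, symmetric] by (simp add: algebra_simps)
    also have "\<dots> \<le> real (card Q) * (5 * L)" using J by (intro mult_left_mono) auto
    finally show ?thesis .
  qed (simp add: sdtga_run_empty)
  then have "expect_subset p N (\<lambda>Q. real (snd (sdtga_run f us I r \<epsilon> Q)))
      \<le> expect_subset p N (\<lambda>Q. real (card Q) * (5 * L))"
    by (intro expect_subset_mono fin)
  also have "\<dots> = p * real (card N) * (5 * L)"
    using fin \<epsilon> p by (simp add: expect_subset_card)
  finally show ?thesis by (simp add: L_def mult_ac)
qed

lemma sdtga_indep:
  assumes ind: "independence_system N I" and sub: "submodular_on N f" and fin: "finite N"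
    and nonneg: "\<And>X. X \<subseteq> N \<Longrightarrow> 0 \<le> f X" and us: "distinct us" "set us = N"
    and r: "r = Max (card ` I)" and \<epsilon>: "0 < \<epsilon>" "\<epsilon> < 1" and Q: "Q \<subseteq> N"
  shows "fst (sdtga_run f us I r \<epsilon> Q) \<in> I"
proof -
  have "{} \<in> I" using ind by (auto simp: independence_system_def)
  then show ?thesis
    using sdtga_run_eq_greedy(1)[OF ind sub fin nonneg us r \<epsilon> Q]
    by (cases "Q = {}") (simp_all add: sdtga_run_empty greedy_indep)
qed

text \<open>An element that is not independent on its own may still determine \<open>d\<close> and
  push all thresholds above the gains of the selectable elements; hence the two value bounds ask for
  independent singletons. For \<open>k = 0\<close> and \<open>r = 1\<close>,
  \<open>\<epsilon>\<close> may approach 1 and the logarithm 0, while at least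
  \<open>p * card N\<close> evaluations are expected; this is excluded by \<open>1 \<le> k\<close>,
  and \<open>1 \<le> r\<close> keeps the argument of the logarithm positive.\<close>

theorem theorem1:
  shows "\<exists>C::real. C > 0 \<and>
    (\<forall>(N::'a set) us I (k::nat) (r::nat) (f::'a set \<Rightarrow> real) OPT (p::real) (\<epsilon>::real).
      finite N \<and> distinct us \<and> set us = N \<and>
      k_extendible k N I \<and> r = Max (card ` I) \<and>
      f {} = 0 \<and> (\<forall>X. X \<subseteq> N \<longrightarrow> f X \<ge> 0) \<and> submodular_on N f \<and>
      is_arg_max f (\<lambda>A. A \<in> I) OPT \<and>
      0 < p \<and> p \<le> 1 / (1 + real k) \<and> 0 < \<epsilon> \<and> \<epsilon> < p \<longrightarrow>
      (\<forall>(S, q) \<in> set_pmf (sdtga f us I r p \<epsilon>). S \<in> I) \<and>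
      ((\<forall>u \<in> N. {u} \<in> I) \<longrightarrow>
        (mono_on (Pow N) f \<longrightarrow>
          measure_pmf.expectation (sdtga f us I r p \<epsilon>) (\<lambda>(S, q). f S)
            \<ge> (p - \<epsilon>) * f OPT) \<and>
        measure_pmf.expectation (sdtga f us I r p \<epsilon>) (\<lambda>(S, q). f S)
          \<ge> (p * (1 - p) - \<epsilon>) * f OPT) \<and>
      (1 \<le> k \<and> 1 \<le> r \<longrightarrow>
        measure_pmf.expectation (sdtga f us I r p \<epsilon>) (\<lambda>(S, q). real q)
          \<le> C * (p * real (card N) / \<epsilon> * ln (real r / \<epsilon>))))"
proof (intro exI[of _ "5::real"] conjI allI impI; (elim conjE)?)
  fix N :: "'a set" and us I and k r :: nat and f :: "'a set \<Rightarrow> real" and OPT and p \<epsilon> :: real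
  assume fin: "finite N" and us: "distinct us" "set us = N" and ext: "k_extendible k N I"
    and r: "r = Max (card ` I)" and f: "f {} = 0" "\<forall>X. X \<subseteq> N \<longrightarrow> f X \<ge> 0" and sub: "submodular_on N f"
    and OPT: "is_arg_max f (\<lambda>A. A \<in> I) OPT"
    and p: "0 < p" "p \<le> 1 / (1 + real k)" and \<epsilon>: "0 < \<epsilon>" "\<epsilon> < p"
  interpret sampled_greedy N I k f p \<epsilon>
    by unfold_locales (use fin ext sub f p \<epsilon> in auto)
  have OPT_I: "OPT \<in> I" using OPT by (simp add: is_arg_max_def)
  show "\<forall>(S, q)\<in>set_pmf (sdtga f us I r p \<epsilon>). S \<in> I"
  proof (intro ballI)
    fix x assume "x \<in> set_pmf (sdtga f us I r p \<epsilon>)"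
    then obtain Q where "Q \<in> set_pmf (random_subset N p)" and x: "x = sdtga_run f us I r \<epsilon> Q"
      unfolding sdtga_def us(2) set_map_pmf by (elim imageE)
    then have "Q \<subseteq> N" using set_random_subset[of N p] by auto
    from sdtga_indep[OF ind sub fin f_nonneg us r \<epsilon>(1) \<epsilon>_less_1 this]
    show "case x of (S, q) \<Rightarrow> S \<in> I" by (simp add: x case_prod_beta)
  qed
  have expect_eq: "measure_pmf.expectation (sdtga f us I r p \<epsilon>) (\<lambda>(S, q). f S) =
      expect_subset p N (\<lambda>Q. f (fst (sdtga_run f us I r \<epsilon> Q)))"
    by (simp add: sdtga_def us case_prod_beta)
  {
    assume "\<forall>u\<in>N. {u} \<in> I"
    then interpret sdtga_sampling N I k f p \<epsilon> us r
      by unfold_locales (use us r in auto)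
    show "(p - \<epsilon>) * f OPT \<le> measure_pmf.expectation (sdtga f us I r p \<epsilon>) (\<lambda>(S, q). f S)"
      if "mono_on (Pow N) f"
      using expected_selection_ge_monotone[OF OPT_I that] by (simp add: expect_eq selection_def)
    show "(p * (1 - p) - \<epsilon>) * f OPT \<le> measure_pmf.expectation (sdtga f us I r p \<epsilon>) (\<lambda>(S, q). f S)"
      using expected_selection_ge_nonmonotone[OF OPT_I] by (simp add: expect_eq selection_def)
  }
  assume k: "1 \<le> k" and r1: "1 \<le> r"
  have "p \<le> 1 / 2" using p(2) by (rule order_trans) (use k in \<open>simp add: divide_simps\<close>)
  from expected_queries_le[OF ind sub fin f_nonneg us r r1 \<epsilon> this]
  show "measure_pmf.expectation (sdtga f us I r p \<epsilon>) (\<lambda>(S, q). real q)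
      \<le> 5 * (p * real (card N) / \<epsilon> * ln (real r / \<epsilon>))"
    by (simp add: sdtga_def us case_prod_beta)
qed simp

end
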